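(* In the undiscounted experimentation game with $N\ge1$ players described in the context, let $\kappa_n\in\mathcal K$ be a reasonable strategy of player $n$. Then for every profile $\kappa_{\neg n}\in\mathcal K^{N-1}$ of strategies of the other players, the expected payoff $u_n(\pi|\kappa_n,\kappa_{\neg n})$ is finite for every $\pi\in\Delta_L$, and the function $\pi\mapsto u_n(\pi|\kappa_n,\kappa_{\neg n})$ is bounded on $\Delta_L$.
   Context: **Primitives.** Let $N\ge 1$ (number of players) and $L\ge1$ be integers, and let $s>0$, $k_0>0$, $\sigma>0$. There is an unknown state $\ell\in\{0,1,\dots,L\}$. For each $\ell$ let $\rho_\ell\in\mathbb R$ (drift) and let $\nu_\ell$ be a finite Borel measure on $\mathbb R\setminus\{0\}$ with $\int h^2\,\nu_\ell(dh)<\infty$ (Lévy measure, possibly zero); put $\lambda_\ell=\nu_\ell(\mathbb R\setminus\{0\})$ and $\mu_\ell=\rho_\ell+\int h\,\nu_\ell(dh)$. Assume $\mu_0<\mu_1<\dots<\mu_L$ and $\mu_0<s<\mu_L$. **Beliefs.** $\Delta_L=\{\pi\in\mathbb R_+^L:\sum_{\ell=1}^L\pi_\ell\le1\}$; $\pi_\ell$ is the probability of state $\ell$, and the probability of state $0$ is $1-\sum_{\ell=1}^L\pi_\ell$, which is what the symbol $\pi_0$ means in sums over states. Set $$m(\pi)=\sum_{\ell=0}^L\pi_\ell\mu_\ell,\qquad f(\pi)=\sum_{\ell=0}^L\pi_\ell\max\{s,\mu_\ell\}.$$ **Strategies and belief dynamics.** The strategy space $\mathcal K$ is the set of Lipschitz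 continuous functions $\Delta_L\to[0,1]$; $\kappa_n(\pi)$ is the fraction of player $n$'s unit resource allocated to the risky arm at belief $\pi$ (the rest goes to a safe arm paying $s$ per unit of time). The risky payoff processes $X^n$ ($n=1,\dots,N$) and the background signal $X^0$ are, conditionally on the state $\ell$, i.i.d. Lévy processes $X^n_t=\rho_\ell t+\sigma Z^n_t+Y^n_t$ with $Z^n$ a standard Wiener process and $Y^n$ an independent compound Poisson process with Lévy measure $\nu_\ell$. All players observe all actions, the time-changed processes $X^n_{\tau^n(t)}$ with $\tau^n(t)=\int_0^t\kappa_n(\pi_{r-})\,dr$ for $n\ge1$, and $X^0_{k_0t}$. The state is drawn according to the prior $\pi\in\Delta_L$, and $\pi_t\in\Delta_L$ is the vector of common posterior probabilities of states $1,\dots,L$ given observations up to time $t$, with initial value $\pi$. Each profile in $\mathcal K^N$ induces a well-defined Markov belief process, with generator $[k_0+\sum_{n=1}^N\kappa_n(\pi)]\,\mathcal G$, where for $C^2$ functions $u$ $$\mathcal Gu(\pi)=\frac1{2\sigma^2}\sum_{i,\ell=1}^L\pi_i\pi_\ell[\rho_i-\rho(\pi)][\rho_\ell-\rho(\pi)]\frac{\partial^2u(\pi)}{\partial\pi_i\partial\pi_\ell}+\int_{\mathbb R\setminus\{0\}}[u(j(\pi,h))-u(\pi)]\,\nu(\pi)(dh)-\sum_{\ell=1}^L\pi_\ell(\lambda_\ell-\lambda(\pi))\frac{\partial u(\pi)}{\partial\pi_\ell},$$ with $\rho(\pi)=\sum_{\ell=0}^L\pi_\ell\rho_\ell$, $\nu(\pi)=\sum_{\ell=0}^L\pi_\ell\nu_\ell$,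 $\lambda(\pi)=\sum_{\ell=0}^L\pi_\ell\lambda_\ell$, and $j_\ell(\pi,\cdot)$ the Radon–Nikodym derivative of $\pi_\ell\nu_\ell$ with respect to $\nu(\pi)$. **Payoffs (strong long-run average criterion).** $$u_n(\pi|\kappa_1,\dots,\kappa_N)=\mathbb E\Big[\int_0^\infty\{[1-\kappa_n(\pi_t)]s+\kappa_n(\pi_t)m(\pi_t)-f(\pi_t)\}\,dt\Big]\in[-\infty,0],$$ where the belief process starts at $\pi$ and evolves under the profile $(\kappa_1,\dots,\kappa_N)$; $(\kappa_n,\kappa_{\neg n})$ denotes the profile in which $n$ uses $\kappa_n$ and the others use $\kappa_{\neg n}$. **Reasonable strategies.** Let $\Delta_L^1$ be the set of $\pi\in\Delta_L$ such that $\pi_\ell=0$ whenever $\mu_\ell<s$, and $\Delta_L^0$ the set of $\pi\in\Delta_L$ such that $\pi_\ell=0$ whenever $\mu_\ell>s$ (here $\ell$ ranges over $0,\dots,L$). A strategy $\kappa_n\in\mathcal K$ is reasonable if $\Delta_L^1$ is contained in the interior of $\kappa_n^{-1}(1)$ and $\Delta_L^0$ is contained in the interior of $\kappa_n^{-1}(0)$, interiors being taken relative to $\Delta_L$. *)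

theory Defs
  imports "HOL-Probability.Probability" "HOL-Library.Option_ord"
begin

text \<open>
  The number \<open>L\<close> of nonzero states is the cardinality of a finite linear order \<open>'l\<close>; the states
  \<open>0, 1, \<dots>, L\<close> are the elements of \<open>'l option\<close>, with \<open>None\<close> (the least element) in the role of
  state 0.  A belief is a vector in \<open>real ^ 'l\<close>.  Players are \<open>1, \<dots>, N\<close>, and index 0
  is reserved for the background signal.
\<close>

record 'l game =
  players :: nat
  safe :: real
  bgrate :: real
  vol :: real
  drift :: "'l option \<Rightarrow> real"
  levy :: "'l option \<Rightarrow> real measure"

definition jump_rate :: "'l game \<Rightarrow> 'l option \<Rightarrow> real" where
  "jump_rate G l = measure (levy G l) UNIV"

definition mean_payoff :: "'l game \<Rightarrow> 'l option \<Rightarrow> real" where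
  "mean_payoff G l = drift G l + (\<integral>h. h \<partial>levy G l)"

text \<open>A measure on the reals without the origin is a Borel measure giving mass zero to the origin.\<close>

definition experimentation_game :: "'l::{finite,linorder} game \<Rightarrow> bool" where
  "experimentation_game G \<longleftrightarrow>
     1 \<le> players G \<and> 0 < safe G \<and> 0 < bgrate G \<and> 0 < vol G \<and>
     (\<forall>l. sets (levy G l) = sets borel \<and> finite_measure (levy G l) \<and>
          emeasure (levy G l) {0} = 0 \<and> integrable (levy G l) (\<lambda>h. h\<^sup>2)) \<and>
     strict_mono (mean_payoff G) \<and>
     mean_payoff G None < safe G \<and> safe G < mean_payoff G (Some (Max UNIV))"


section \<open>Beliefs\<close>

definition beliefs :: "(real ^ 'l) set" where
  "beliefs = {p. (\<forall>l. 0 \<le> p $ l) \<and> (\<Sum>l\<in>UNIV. p $ l) \<le> 1}"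

definition state_prob :: "real ^ 'l \<Rightarrow> 'l option \<Rightarrow> real" where
  "state_prob p l = (case l of None \<Rightarrow> 1 - (\<Sum>k\<in>UNIV. p $ k) | Some k \<Rightarrow> p $ k)"

definition avg :: "('l option \<Rightarrow> real) \<Rightarrow> real ^ 'l::finite \<Rightarrow> real" where
  "avg a p = (\<Sum>l\<in>UNIV. state_prob p l * a l)"

definition exp_payoff :: "'l::finite game \<Rightarrow> real ^ 'l \<Rightarrow> real" where
  "exp_payoff G = avg (mean_payoff G)"

definition full_info_payoff :: "'l::finite game \<Rightarrow> real ^ 'l \<Rightarrow> real" where
  "full_info_payoff G = avg (\<lambda>l. max (safe G) (mean_payoff G l))"


section \<open>Strategies\<close>

text \<open>Only the values of a strategy on \<open>beliefs\<close> matter.\<close>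

definition strategies :: "(real ^ 'l::finite \<Rightarrow> real) set" where
  "strategies = {\<kappa>. (\<exists>C. C-lipschitz_on beliefs \<kappa>) \<and> \<kappa> ` beliefs \<subseteq> {0..1}}"

definition beliefs_above :: "'l::finite game \<Rightarrow> (real ^ 'l) set" where
  "beliefs_above G = {p \<in> beliefs. \<forall>l. mean_payoff G l < safe G \<longrightarrow> state_prob p l = 0}"

definition beliefs_below :: "'l::finite game \<Rightarrow> (real ^ 'l) set" where
  "beliefs_below G = {p \<in> beliefs. \<forall>l. mean_payoff G l > safe G \<longrightarrow> state_prob p l = 0}"

definition reasonable :: "'l::finite game \<Rightarrow> (real ^ 'l \<Rightarrow> real) \<Rightarrow> bool" where
  "reasonable G \<kappa> \<longleftrightarrow> \<kappa> \<in> strategies \<and>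
     beliefs_above G \<subseteq> top_of_set beliefs interior_of {p \<in> beliefs. \<kappa> p = 1} \<and>
     beliefs_below G \<subseteq> top_of_set beliefs interior_of {p \<in> beliefs. \<kappa> p = 0}"


section \<open>The generator\<close>

definition partial_deriv :: "'l \<Rightarrow> (real ^ 'l \<Rightarrow> real) \<Rightarrow> real ^ 'l::finite \<Rightarrow> real" where
  "partial_deriv l u p = deriv (\<lambda>t. u (p + t *\<^sub>R axis l 1)) 0"

definition C1 :: "(real ^ 'l::finite \<Rightarrow> real) \<Rightarrow> bool" where
  "C1 u \<longleftrightarrow> (\<forall>l p. (\<lambda>t. u (p + t *\<^sub>R axis l 1)) field_differentiable at 0) \<and>
             (\<forall>l. continuous_on UNIV (partial_deriv l u))"

definition C2 :: "(real ^ 'l::finite \<Rightarrow> real) \<Rightarrow> bool" where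
  "C2 u \<longleftrightarrow> C1 u \<and> (\<forall>l. C1 (partial_deriv l u))"

definition levy_mix :: "'l::finite game \<Rightarrow> real ^ 'l \<Rightarrow> real measure" where
  "levy_mix G p = measure_of UNIV (sets borel)
     (\<lambda>A. \<Sum>l\<in>UNIV. ennreal (state_prob p l) * emeasure (levy G l) A)"

definition jump_target :: "'l::finite game \<Rightarrow> real ^ 'l \<Rightarrow> real \<Rightarrow> real ^ 'l" where
  "jump_target G p h =
     (\<chi> l. enn2real (RN_deriv (levy_mix G p)
                       (scale_measure (ennreal (p $ l)) (levy G (Some l))) h))"

text \<open>
  Test functions are \<open>C\<^sup>2\<close> on the whole space.  For arguments in \<open>beliefs\<close> the value of the
  generator depends only on the restriction of the test function to \<open>beliefs\<close>, and every
  function that is \<open>C\<^sup>2\<close> up to the boundary of the simplex has such an extension.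
\<close>

definition generator :: "'l::finite game \<Rightarrow> (real ^ 'l \<Rightarrow> real) \<Rightarrow> real ^ 'l \<Rightarrow> real" where
  "generator G u p =
     1 / (2 * (vol G)\<^sup>2) *
       (\<Sum>i\<in>UNIV. \<Sum>l\<in>UNIV. p $ i * p $ l *
          (drift G (Some i) - avg (drift G) p) * (drift G (Some l) - avg (drift G) p) *
          partial_deriv i (partial_deriv l u) p)
     + (\<integral>h. (u (jump_target G p h) - u p) \<partial>levy_mix G p)
     - (\<Sum>l\<in>UNIV. p $ l * (jump_rate G (Some l) - avg (jump_rate G) p) * partial_deriv l u p)"

definition profile_generator ::
  "'l::finite game \<Rightarrow> (nat \<Rightarrow> real ^ 'l \<Rightarrow> real) \<Rightarrow> (real ^ 'l \<Rightarrow> real) \<Rightarrow> real ^ 'l \<Rightarrow> real" where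
  "profile_generator G \<kappa> u p = (bgrate G + (\<Sum>n=1..players G. \<kappa> n p)) * generator G u p"


section \<open>Stochastic processes indexed by nonnegative time\<close>

definition cadlag :: "(real \<Rightarrow> 'a::topological_space) \<Rightarrow> bool" where
  "cadlag f \<longleftrightarrow> (\<forall>t\<ge>0. (f \<longlongrightarrow> f t) (at_right t)) \<and> (\<forall>t>0. \<exists>y. (f \<longlongrightarrow> y) (at_left t))"

definition left_limit :: "(real \<Rightarrow> 'a::t2_space) \<Rightarrow> real \<Rightarrow> 'a" where
  "left_limit f t = (if t \<le> 0 then f 0 else Lim (at_left t) f)"

definition path :: "(real \<Rightarrow> 'w \<Rightarrow> real) \<Rightarrow> 'w \<Rightarrow> real \<Rightarrow> real" where
  "path V w = (\<lambda>t\<in>{0..}. V t w)"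

definition indep_increments :: "'w measure \<Rightarrow> (real \<Rightarrow> 'w \<Rightarrow> real) \<Rightarrow> bool" where
  "indep_increments P V \<longleftrightarrow>
     (\<forall>(m::nat) (r::nat \<Rightarrow> real). mono r \<and> 0 \<le> r 0 \<longrightarrow>
        prob_space.indep_vars P (\<lambda>_. borel) (\<lambda>i w. V (r (Suc i)) w - V (r i) w) {..<m})"

definition wiener_process :: "'w measure \<Rightarrow> (real \<Rightarrow> 'w \<Rightarrow> real) \<Rightarrow> bool" where
  "wiener_process P Z \<longleftrightarrow>
     (\<forall>w\<in>space P. Z 0 w = 0 \<and> continuous_on {0..} (\<lambda>t. Z t w)) \<and>
     indep_increments P Z \<and>
     (\<forall>q t. 0 \<le> q \<and> q < t \<longrightarrow>
        distributed P lborel (\<lambda>w. Z t w - Z q w) (normal_density 0 (sqrt (t - q))))"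

definition poisson_process :: "'w measure \<Rightarrow> real \<Rightarrow> (real \<Rightarrow> 'w \<Rightarrow> nat) \<Rightarrow> bool" where
  "poisson_process P r Q \<longleftrightarrow>
     (AE w in P. Q 0 w = 0 \<and> cadlag (\<lambda>t. Q t w)) \<and>
     indep_increments P (\<lambda>t w. real (Q t w)) \<and>
     (\<forall>q t k. 0 \<le> q \<and> q \<le> t \<longrightarrow>
        measure P {w \<in> space P. real (Q t w) - real (Q q w) = real k} =
          exp (- r * (t - q)) * (r * (t - q)) ^ k / fact k)"

text \<open>
  Jumps occur at rate \<open>r\<close>, the total mass of \<open>\<nu>\<close>; their sizes are i.i.d. with law \<open>\<nu> / r\<close>.
  For \<open>\<nu> = 0\<close> the condition on the jump sizes is empty and the process vanishes.
\<close>

definition compound_poisson :: "'w measure \<Rightarrow> real measure \<Rightarrow> (real \<Rightarrow> 'w \<Rightarrow> real) \<Rightarrow> bool" where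
  "compound_poisson P \<nu> Y \<longleftrightarrow>
     (\<exists>(Q :: real \<Rightarrow> 'w \<Rightarrow> nat) (J :: nat \<Rightarrow> 'w \<Rightarrow> real).
        poisson_process P (measure \<nu> UNIV) Q \<and>
        prob_space.indep_vars P (\<lambda>_. borel) J UNIV \<and>
        (\<forall>k. scale_measure (emeasure \<nu> UNIV) (distr P borel (J k)) = \<nu>) \<and>
        prob_space.indep_set P
          (sets (vimage_algebra (space P) (path (\<lambda>t w. real (Q t w))) (PiM {0..} (\<lambda>_. borel))))
          (sets (vimage_algebra (space P) (\<lambda>w k. J k w) (PiM UNIV (\<lambda>_. borel)))) \<and>
        (AE w in P. \<forall>t\<ge>0. Y t w = (\<Sum>k<Q t w. J k w)))"

definition martingale :: "'w measure \<Rightarrow> (real \<Rightarrow> 'w measure) \<Rightarrow> (real \<Rightarrow> 'w \<Rightarrow> real) \<Rightarrow> bool" where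
  "martingale M F V \<longleftrightarrow>
     (\<forall>t\<ge>0. integrable M (V t) \<and> V t \<in> borel_measurable (F t)) \<and>
     (\<forall>q t. 0 \<le> q \<and> q \<le> t \<longrightarrow> (AE w in M. real_cond_exp M (F q) (V t) w = V q w))"

definition markov_process ::
  "'w measure \<Rightarrow> (real \<Rightarrow> 'w measure) \<Rightarrow> (real \<Rightarrow> 'w \<Rightarrow> 'a::topological_space) \<Rightarrow> bool" where
  "markov_process M F b \<longleftrightarrow>
     (\<forall>t\<ge>0. b t \<in> borel_measurable (F t)) \<and>
     (\<forall>q t (\<phi>::'a \<Rightarrow> real). 0 \<le> q \<and> q \<le> t \<and> \<phi> \<in> borel_measurable borel \<and> bounded (range \<phi>) \<longrightarrow>
        (AE w in M. real_cond_exp M (F q) (\<lambda>w. \<phi> (b t w)) w =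
           real_cond_exp M (vimage_algebra (space M) (b q) borel) (\<lambda>w. \<phi> (b t w)) w))"


section \<open>Play of the game\<close>

text \<open>
  A play consists of a probability space carrying the random state, the Wiener components
  \<open>Z\<^sup>n\<close> and jump components \<open>Y\<^sup>n\<close> (\<open>n = 0, \<dots>, N\<close>) of the payoff and background
  processes, and the belief process.
\<close>

record ('w, 'l) play =
  sample :: "'w measure"
  state :: "'w \<Rightarrow> 'l option"
  gaussian :: "nat \<Rightarrow> real \<Rightarrow> 'w \<Rightarrow> real"
  jumps :: "nat \<Rightarrow> real \<Rightarrow> 'w \<Rightarrow> real"
  belief :: "real \<Rightarrow> 'w \<Rightarrow> real ^ 'l"

definition given_state :: "('w, 'l::finite) play \<Rightarrow> 'l option \<Rightarrow> 'w measure" where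
  "given_state E l = uniform_measure (sample E) {w \<in> space (sample E). state E w = l}"

definition signal :: "'l::finite game \<Rightarrow> ('w, 'l) play \<Rightarrow> nat \<Rightarrow> real \<Rightarrow> 'w \<Rightarrow> real" where
  "signal G E n t w = drift G (state E w) * t + vol G * gaussian E n t w + jumps E n t w"

definition action ::
  "(nat \<Rightarrow> real ^ 'l::finite \<Rightarrow> real) \<Rightarrow> ('w, 'l) play \<Rightarrow> nat \<Rightarrow> real \<Rightarrow> 'w \<Rightarrow> real" where
  "action \<kappa> E n t w = \<kappa> n (left_limit (\<lambda>r. belief E r w) t)"

definition clock ::
  "'l::finite game \<Rightarrow> (nat \<Rightarrow> real ^ 'l \<Rightarrow> real) \<Rightarrow> ('w, 'l) play \<Rightarrow> nat \<Rightarrow> real \<Rightarrow> 'w \<Rightarrow> real" where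
  "clock G \<kappa> E n t w =
     (if n = 0 then bgrate G * t else set_lebesgue_integral lborel {0..t} (\<lambda>r. action \<kappa> E n r w))"

definition observed ::
  "'l::finite game \<Rightarrow> (nat \<Rightarrow> real ^ 'l \<Rightarrow> real) \<Rightarrow> ('w, 'l) play \<Rightarrow> nat \<Rightarrow> real \<Rightarrow> 'w \<Rightarrow> real" where
  "observed G \<kappa> E n t w = signal G E n (clock G \<kappa> E n t w) w"

text \<open>The information available at time \<open>t\<close>, augmented by the null events.\<close>

definition information ::
  "'l::finite game \<Rightarrow> (nat \<Rightarrow> real ^ 'l \<Rightarrow> real) \<Rightarrow> ('w, 'l) play \<Rightarrow> real \<Rightarrow> 'w measure" where
  "information G \<kappa> E t = sigma (space (sample E))
     (null_sets (sample E)
      \<union> {observed G \<kappa> E n q -` A \<inter> space (sample E) | n q A.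
            n \<le> players G \<and> 0 \<le> q \<and> q \<le> t \<and> A \<in> sets borel}
      \<union> {action \<kappa> E n q -` A \<inter> space (sample E) | n q A.
            1 \<le> n \<and> n \<le> players G \<and> 0 \<le> q \<and> q \<le> t \<and> A \<in> sets borel})"

text \<open>
  The state is drawn from the prior \<open>p\<close>.  Given the state, the processes \<open>Z\<^sup>0, \<dots>, Z\<^sup>N, Y\<^sup>0, \<dots>, Y\<^sup>N\<close>
  are independent, each \<open>Z\<^sup>n\<close> is a standard Wiener process and each \<open>Y\<^sup>n\<close> is compound Poisson
  with the Levy measure of that state.
\<close>

definition state_and_noise :: "'l::finite game \<Rightarrow> real ^ 'l \<Rightarrow> ('w, 'l) play \<Rightarrow> bool" where
  "state_and_noise G p E \<longleftrightarrow>
     prob_space (sample E) \<and>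
     state E \<in> measurable (sample E) (count_space UNIV) \<and>
     (\<forall>l. measure (sample E) {w \<in> space (sample E). state E w = l} = state_prob p l) \<and>
     (\<forall>n\<le>players G. \<forall>w\<in>space (sample E). cadlag (\<lambda>t. jumps E n t w)) \<and>
     (\<forall>l. 0 < state_prob p l \<longrightarrow>
        (\<forall>n\<le>players G. wiener_process (given_state E l) (gaussian E n) \<and>
                        compound_poisson (given_state E l) (levy G l) (jumps E n)) \<and>
        prob_space.indep_vars (given_state E l) (\<lambda>_. PiM {0..} (\<lambda>_. borel))
          (\<lambda>(n, is_jump). path (if is_jump then jumps E n else gaussian E n))
          ({..players G} \<times> UNIV))"

text \<open>
  \<open>play_of G \<kappa> p E\<close>: the belief process of \<open>E\<close> starts at \<open>p\<close> and evolves under the profile \<open>\<kappa>\<close>.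
  It is a version, with right-continuous paths having left limits, of the vector of posterior
  probabilities of the states \<open>1, \<dots>, L\<close> given the available information, and it is a Markov
  process whose generator, in the sense of the martingale problem on \<open>C\<^sup>2\<close> functions, is
  \<open>profile_generator G \<kappa>\<close>.
\<close>

definition play_of ::
  "'l::finite game \<Rightarrow> (nat \<Rightarrow> real ^ 'l \<Rightarrow> real) \<Rightarrow> real ^ 'l \<Rightarrow> ('w, 'l) play \<Rightarrow> bool" where
  "play_of G \<kappa> p E \<longleftrightarrow>
     state_and_noise G p E \<and>
     (\<forall>w\<in>space (sample E). belief E 0 w = p \<and> (\<forall>t\<ge>0. belief E t w \<in> beliefs) \<and>
                             cadlag (\<lambda>t. belief E t w)) \<and>
     (\<forall>t\<ge>0. \<forall>l. AE w in sample E. belief E t w $ l =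
        real_cond_exp (sample E) (information G \<kappa> E t)
          (indicator {w \<in> space (sample E). state E w = Some l}) w) \<and>
     markov_process (sample E) (information G \<kappa> E) (belief E) \<and>
     (\<forall>u. C2 u \<longrightarrow>
        martingale (sample E) (information G \<kappa> E)
          (\<lambda>t w. u (belief E t w) -
             set_lebesgue_integral lborel {0..t} (\<lambda>r. profile_generator G \<kappa> u (belief E r w))))"


section \<open>Payoffs\<close>

definition payoff_rate ::
  "'l::finite game \<Rightarrow> (real ^ 'l \<Rightarrow> real) \<Rightarrow> real ^ 'l \<Rightarrow> real" where
  "payoff_rate G \<kappa> p = (1 - \<kappa> p) * safe G + \<kappa> p * exp_payoff G p - full_info_payoff G p"

text \<open>
  The payoff rate is nonpositive on \<open>beliefs\<close>, so its expected time integral, a value in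
  \<open>[-\<infinity>, 0]\<close>, is the negative of a nonnegative integral.
\<close>

definition payoff ::
  "'l::finite game \<Rightarrow> (nat \<Rightarrow> real ^ 'l \<Rightarrow> real) \<Rightarrow> ('w, 'l) play \<Rightarrow> nat \<Rightarrow> ereal" where
  "payoff G \<kappa> E n =
     - enn2ereal (\<integral>\<^sup>+ w. (\<integral>\<^sup>+ t\<in>{0..}. ennreal (- payoff_rate G (\<kappa> n) (belief E t w)) \<partial>lborel) \<partial>sample E)"

end

theory Submission
  imports Defs
begin

text \<open>
  Write the payoff shortfall at \<open>\<pi>\<close> as \<open>(1 - \<kappa>) A + \<kappa> B\<close> with \<open>A = E\<^sub>\<pi>[(\<mu> - s)\<^sup>+]\<close> and
  \<open>B = E\<^sub>\<pi>[(s - \<mu>)\<^sup>+]\<close>.  By compactness a reasonable strategy has shortfall at most a constant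
  times \<open>A B\<close>, and \<open>2 A B \<le> Var\<^sub>\<pi>(\<mu>)\<close>.  The negative entropy of the belief is bounded and its drift is
  the rate of information acquisition, which dominates a multiple of \<open>Var\<^sub>\<pi>(\<mu>)\<close> because distinct
  means make the Levy processes distinguishable.  Hence the expected time integral of \<open>Var\<^sub>\<pi>(\<mu>)\<close>
  is bounded uniformly in the prior.  Entropy is not \<open>C\<^sup>2\<close> at the boundary of the simplex, so
  \<open>x ln x\<close> is replaced by \<open>x ln (x + r) - r\<close> with \<open>r = sqrt (x\<^sup>2 + e\<^sup>2)\<close>, whose second derivative
  is \<open>1 / r\<close>, and Fatou's lemma is applied as the horizon grows and \<open>e\<close> tends to 0.
\<close>

section \<open>Beliefs\<close>

text \<open>The estimate must hold whatever the others play. The background signal secures this: it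
  runs at rate \<open>bgrate G\<close> under every profile, and extra experimentation only adds to
  the drift of the entropy, which is nonnegative. The posterior of state l integrates against the
  jump mixture to \<pi>_l \<lambda>_l, so the first-order term of the generator is exactly the
  compensator of the linear part of the jump integrand. What remains is the integral of a Bregman
  divergence plus a diffusion term. Both are nonnegative, so differences in drift and differences in
  mean jump are exploited separately and cannot cancel; the second moments of the Levy measures
  convert the divergence into squared differences of mean jumps. The smoothing has to keep the
  entropy bounded uniformly in e, since this is the bound that survives the limit. The bounds that
  merely secure integrability may depend on e.\<close>

lemma sum_UNIV_option:
  "(\<Sum>l\<in>UNIV. f l) = f None + (\<Sum>k\<in>UNIV. f (Some k))" for f :: "'l::finite option \<Rightarrow> 'b::comm_monoid_add"
  by (simp add: UNIV_option_conv sum.reindex)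

lemma sum_state_prob: "(\<Sum>l\<in>UNIV. state_prob p l) = 1" for p :: "real ^ 'l::finite"
  by (simp add: sum_UNIV_option state_prob_def)

lemma state_prob_nonneg: "p \<in> beliefs \<Longrightarrow> 0 \<le> state_prob p l" for p :: "real ^ 'l::finite"
  by (auto simp: beliefs_def state_prob_def split: option.split)

lemma state_prob_le_1:
  fixes p :: "real ^ 'l::finite"
  assumes "p \<in> beliefs"
  shows "state_prob p l \<le> 1"
  using member_le_sum[of l UNIV "state_prob p"] state_prob_nonneg[OF assms] sum_state_prob[of p] by simp

lemma continuous_state_prob [continuous_intros]:
  "continuous_on S (\<lambda>p. state_prob p l)" for S :: "(real ^ 'l::finite) set"
  by (cases l) (auto simp: state_prob_def intro!: continuous_intros)

lemma measurable_state_prob [measurable]: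
  "(\<lambda>p. state_prob p l) \<in> borel_measurable borel" for l :: "'l::finite option"
  by (intro borel_measurable_continuous_onI continuous_intros)

lemma compact_beliefs: "compact (beliefs :: (real ^ 'l::finite) set)"
proof -
  have "beliefs = (\<Inter>l. {p. 0 \<le> p $ l}) \<inter> {p::real^'l. (\<Sum>l\<in>UNIV. p $ l) \<le> 1}"
    by (auto simp: beliefs_def)
  also have "closed \<dots>"
    by (intro closed_Int closed_INT ballI closed_Collect_le continuous_intros)
  finally have "closed (beliefs :: (real ^ 'l) set)" .
  moreover have "norm p \<le> real CARD('l)" if "p \<in> beliefs" for p :: "real ^ 'l"
  proof -
    have "norm p \<le> (\<Sum>l\<in>UNIV. \<bar>p $ l\<bar>)" by (rule norm_le_l1_cart)
    also have "\<dots> \<le> (\<Sum>l\<in>(UNIV::'l set). 1)"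
      using state_prob_nonneg[OF that, of "Some _"] state_prob_le_1[OF that, of "Some _"]
      by (intro sum_mono) (simp add: state_prob_def)
    finally show ?thesis by simp
  qed
  ultimately show ?thesis
    by (metis bounded_iff compact_eq_bounded_closed)
qed

section \<open>Regularised entropy\<close>

text \<open>Twice integrated \<open>1 / sqrt (x\<^sup>2 + e\<^sup>2)\<close>, hence smooth on the
  whole line, as test functions must be. At e = 0 and x > 0 it is x ln x plus a multiple of x, and
  such multiples sum to a constant over the states.\<close>

definition smooth_entropy :: "real \<Rightarrow> real \<Rightarrow> real" where
  "smooth_entropy e x = x * ln (x + sqrt (x\<^sup>2 + e\<^sup>2)) - sqrt (x\<^sup>2 + e\<^sup>2)"

text \<open>Negative x matter too: outside the simplex the coordinates of a test function's argument
  have any sign.\<close>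

lemma add_sqrt_pos: "0 < e \<Longrightarrow> 0 < x + sqrt (x\<^sup>2 + e\<^sup>2)" for x e :: real
proof -
  assume "0 < e"
  then have "\<bar>x\<bar> < sqrt (x\<^sup>2 + e\<^sup>2)"
    by (intro real_less_rsqrt) simp
  then show ?thesis by linarith
qed

lemma has_derivative_sqrt_add:
  assumes "0 < e"
  shows "((\<lambda>x. sqrt (x\<^sup>2 + e\<^sup>2)) has_real_derivative x / sqrt (x\<^sup>2 + e\<^sup>2)) (at x)"
proof -
  have "0 < x\<^sup>2 + e\<^sup>2" using assms by (simp add: sum_power2_gt_zero_iff)
  then show ?thesis
    by (auto intro!: derivative_eq_intros simp: field_simps)
qed

lemma ln_add_sqrt_has_derivative:
  assumes "0 < e"
  shows "((\<lambda>x. ln (x + sqrt (x\<^sup>2 + e\<^sup>2))) has_real_derivative 1 / sqrt (x\<^sup>2 + e\<^sup>2)) (at x)"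
proof -
  have p: "0 < sqrt (x\<^sup>2 + e\<^sup>2)" using assms by (simp add: sum_power2_gt_zero_iff)
  have "((\<lambda>x. ln (x + sqrt (x\<^sup>2 + e\<^sup>2))) has_real_derivative
      1 / (x + sqrt (x\<^sup>2 + e\<^sup>2)) * (1 + x / sqrt (x\<^sup>2 + e\<^sup>2))) (at x)"
    using add_sqrt_pos[OF assms]
    by (intro DERIV_chain2[OF DERIV_ln_divide] derivative_intros has_derivative_sqrt_add assms)
  also have "1 / (x + sqrt (x\<^sup>2 + e\<^sup>2)) * (1 + x / sqrt (x\<^sup>2 + e\<^sup>2)) = 1 / sqrt (x\<^sup>2 + e\<^sup>2)"
    using p add_sqrt_pos[OF assms, of x] by (simp add: divide_simps)
  finally show ?thesis .
qed

lemma smooth_entropy_has_derivative: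
  assumes "0 < e"
  shows "(smooth_entropy e has_real_derivative ln (x + sqrt (x\<^sup>2 + e\<^sup>2))) (at x)"
proof -
  have "((\<lambda>x. x * ln (x + sqrt (x\<^sup>2 + e\<^sup>2)) - sqrt (x\<^sup>2 + e\<^sup>2)) has_real_derivative
      1 * ln (x + sqrt (x\<^sup>2 + e\<^sup>2)) + 1 / sqrt (x\<^sup>2 + e\<^sup>2) * x - x / sqrt (x\<^sup>2 + e\<^sup>2)) (at x)"
    by (intro derivative_intros has_derivative_sqrt_add ln_add_sqrt_has_derivative assms)
  then show ?thesis by (simp add: smooth_entropy_def[abs_def])
qed

lemma continuous_inverse_sqrt_add: "0 < e \<Longrightarrow> continuous_on S (\<lambda>x. 1 / sqrt (x\<^sup>2 + e\<^sup>2))" for e :: real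
  by (intro continuous_intros) (auto simp: sum_power2_eq_zero_iff)

text \<open>Independence of e is the point. The lower estimate rests on x ln x \<ge> x - 1 and on
  the monotonicity of ln; the constant 4 is generous.\<close>

lemma smooth_entropy_bound:
  assumes e: "0 < e" "e \<le> 1" and x: "0 \<le> x" "x \<le> 1"
  shows "\<bar>smooth_entropy e x\<bar> \<le> 4"
proof -
  let ?r = "sqrt (x\<^sup>2 + e\<^sup>2)"
  have r: "?r \<le> 2"
    using power_mono[of x 1 2] power_mono[of e 1 2] assms by (intro real_le_lsqrt) auto
  have r0: "0 \<le> ?r" by simp
  have "ln (x + ?r) \<le> x + ?r - 1" using ln_le_minus_one add_sqrt_pos[OF e(1)] by blast
  then have "ln (x + ?r) \<le> 2" using r x by linarith
  then have up: "x * ln (x + ?r) \<le> 2"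
    using mult_left_mono[of "ln (x + ?r)" 2 x] x by linarith
  have lo: "-1 \<le> x * ln (x + ?r)"
  proof (cases "x = 0")
    case False
    then have xp: "0 < x" using x by simp
    have "ln (1 / x) \<le> 1 / x - 1" using ln_le_minus_one[of "1 / x"] xp by simp
    then have "x * ln (1 / x) \<le> 1 - x" using xp mult_left_mono[of "ln (1/x)" "1/x - 1" x] by (simp add: algebra_simps)
    then have "- (1 - x) \<le> x * ln x" using xp by (simp add: ln_div)
    also have "x * ln x \<le> x * ln (x + ?r)" using xp r0 by (intro mult_left_mono ln_mono) auto
    finally show ?thesis using xp by linarith
  qed simp
  show ?thesis unfolding smooth_entropy_def using up lo r r0 by linarith
qed

text \<open>Since the second derivative at \<open>z\<close> is \<open>1 / sqrt (z\<^sup>2 + e\<^sup>2) \<ge> 1 / (z + e)\<close>, this is Taylor's formula.\<close>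
lemma smooth_entropy_bregman:
  assumes e: "0 < e" and x: "0 \<le> x" and y: "0 \<le> y"
  shows "(y - x)\<^sup>2 / (2 * (x + y + e)) \<le>
    smooth_entropy e y - smooth_entropy e x - ln (x + sqrt (x\<^sup>2 + e\<^sup>2)) * (y - x)"
proof (cases "x = y")
  case False
  define df where "df = (\<lambda>n::nat. if n = 0 then smooth_entropy e else if n = 1 then (\<lambda>x. ln (x + sqrt (x\<^sup>2 + e\<^sup>2)))
     else (\<lambda>x. 1 / sqrt (x\<^sup>2 + e\<^sup>2)))"
  have "\<exists>t. (if y < x then y < t \<and> t < x else x < t \<and> t < y) \<and>
      smooth_entropy e y = (\<Sum>m<2. df m x / fact m * (y - x) ^ m) + df 2 t / fact 2 * (y - x) ^ 2"
    by (rule Taylor[of _ _ _ "min x y" "max x y"])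
       (use False e in \<open>auto simp: df_def less_2_cases_iff
          intro: smooth_entropy_has_derivative ln_add_sqrt_has_derivative\<close>)
  then obtain t where t: "min x y < t" "t < max x y" and
    eq: "smooth_entropy e y = smooth_entropy e x + ln (x + sqrt (x\<^sup>2 + e\<^sup>2)) * (y - x) + 1 / sqrt (t\<^sup>2 + e\<^sup>2) / 2 * (y - x)\<^sup>2"
    by (auto simp: df_def numeral_2_eq_2 split: if_splits)
  \<comment> \<open>The sum, unlike the maximum, is affine in y, which makes the resulting weight
    integrable in closed form against the jump mixture.\<close>
  have "0 < t" "t \<le> x + y" using t x y by auto
  then have "sqrt (t\<^sup>2 + e\<^sup>2) \<le> x + y + e"
    using sqrt_sum_squares_le_sum[of t e] e by linarith
  moreover have "0 < sqrt (t\<^sup>2 + e\<^sup>2)" using e by (simp add: sum_power2_gt_zero_iff)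
  ultimately have "1 / (x + y + e) \<le> 1 / sqrt (t\<^sup>2 + e\<^sup>2)"
    by (intro divide_left_mono mult_pos_pos) (use x y e in auto)
  from mult_right_mono[OF this, of "(y - x)\<^sup>2 / 2"]
  have "(y - x)\<^sup>2 / (2 * (x + y + e)) \<le> 1 / sqrt (t\<^sup>2 + e\<^sup>2) / 2 * (y - x)\<^sup>2"
    by (simp add: mult_ac)
  then show ?thesis unfolding eq by simp
qed auto

section \<open>The generator on functions of single state probabilities\<close>

text \<open>The partial derivative of \<open>state_prob p l\<close> in coordinate k, constant
  because \<open>state_prob\<close> is affine.\<close>

definition state_coord :: "'l option \<Rightarrow> 'l \<Rightarrow> real" where
  "state_coord l k = (case l of None \<Rightarrow> -1 | Some j \<Rightarrow> if j = k then 1 else 0)"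

lemma state_prob_add_axis:
  "state_prob (p + t *\<^sub>R axis k 1) l = state_prob p l + t * state_coord l k" for p :: "real ^ 'l::finite"
  by (auto simp: state_prob_def state_coord_def axis_def sum.distrib sum_distrib_left[symmetric]
      split: option.split)

text \<open>Deviations from the mean, weighted by the probabilities of all states, sum to 0, so the
  entry of state 0 is minus the sum of the others. This restores the symmetry between state 0 and
  the coordinates.\<close>

lemma sum_state_coord:
  fixes p :: "real ^ 'l::finite"
  shows "(\<Sum>k\<in>UNIV. state_coord l k * (p $ k * (a (Some k) - avg a p))) = state_prob p l * (a l - avg a p)"
proof (cases l)
  case None
  have "0 = (\<Sum>k\<in>UNIV. state_prob p k * (a k - avg a p))"
    by (simp add: algebra_simps sum_subtractf sum_distrib_right[symmetric] sum_state_prob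
        sum_distrib_left[symmetric] avg_def)
  also have "\<dots> = state_prob p None * (a None - avg a p) + (\<Sum>k\<in>UNIV. p $ k * (a (Some k) - avg a p))"
    by (simp add: sum_UNIV_option state_prob_def)
  finally show ?thesis using None by (simp add: state_coord_def sum_negf)
next
  case (Some j)
  have "(\<Sum>k\<in>UNIV. state_coord l k * (p $ k * (a (Some k) - avg a p))) =
      (\<Sum>k\<in>UNIV. if j = k then p $ k * (a (Some k) - avg a p) else 0)"
    using Some by (intro sum.cong) (auto simp: state_coord_def)
  then show ?thesis using Some by (simp add: state_prob_def)
qed

text \<open>The weights close this class of functions under partial derivatives: differentiation
  multiplies them by \<open>state_coord\<close>, so second derivatives need no separate
  computation.\<close>

lemma state_prob_sum_has_derivative:
  fixes p :: "real ^ 'l::finite"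
  assumes "\<And>x. (\<psi> has_real_derivative \<psi>' x) (at x)"
  shows "((\<lambda>t. \<Sum>l\<in>UNIV. w l * \<psi> (state_prob (p + t *\<^sub>R axis k 1) l)) has_real_derivative
    (\<Sum>l\<in>UNIV. w l * state_coord l k * \<psi>' (state_prob p l))) (at 0)"
proof -
  have "((\<lambda>t. \<psi> (state_prob p l + t * state_coord l k)) has_real_derivative
      \<psi>' (state_prob p l) * state_coord l k) (at 0)" for l
    by (rule DERIV_chain2[where f = \<psi>]) (auto intro!: derivative_eq_intros assms)
  then show ?thesis unfolding state_prob_add_axis
    by (auto intro!: derivative_eq_intros simp: mult_ac)
qed

lemma partial_deriv_state_prob_sum:
  fixes w :: "'l::finite option \<Rightarrow> real"
  assumes "\<And>x. (\<psi> has_real_derivative \<psi>' x) (at x)"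
  shows "partial_deriv k (\<lambda>p. \<Sum>l\<in>UNIV. w l * \<psi> (state_prob p l)) =
    (\<lambda>p. \<Sum>l\<in>UNIV. w l * state_coord l k * \<psi>' (state_prob p l))"
  unfolding partial_deriv_def
  by (intro ext DERIV_imp_deriv state_prob_sum_has_derivative assms)

lemma C1_state_prob_sum:
  fixes w :: "'l::finite option \<Rightarrow> real"
  assumes "\<And>x. (\<psi> has_real_derivative \<psi>' x) (at x)" and "continuous_on UNIV \<psi>'"
  shows "C1 (\<lambda>p. \<Sum>l\<in>UNIV. w l * \<psi> (state_prob p l))"
  unfolding C1_def partial_deriv_state_prob_sum[OF assms(1)]
  using state_prob_sum_has_derivative[OF assms(1)]
  by (auto simp: field_differentiable_def
      intro!: continuous_intros continuous_on_compose2[OF assms(2)] exI)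

lemma C2_state_prob_sum:
  fixes w :: "'l::finite option \<Rightarrow> real"
  assumes "\<And>x. (\<psi> has_real_derivative \<psi>' x) (at x)"
    and "\<And>x. (\<psi>' has_real_derivative \<psi>'' x) (at x)" and "continuous_on UNIV \<psi>''"
  shows "C2 (\<lambda>p. \<Sum>l\<in>UNIV. w l * \<psi> (state_prob p l))"
proof -
  have "continuous_on UNIV \<psi>'"
    by (meson DERIV_isCont assms(2) continuous_at_imp_continuous_on)
  then show ?thesis
    unfolding C2_def partial_deriv_state_prob_sum[OF assms(1)]
    by (intro conjI allI C1_state_prob_sum[OF assms(1)] C1_state_prob_sum[OF assms(2,3)])
qed

text \<open>By the chain rule the gradients are combinations of \<open>state_coord\<close>, and
  contracting them with the coefficients by \<open>sum_state_coord\<close> collapses the double sum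
  over coordinates to one sum of squares over all states.\<close>

lemma generator_state_prob_sum:
  fixes G :: "'l::finite game"
  assumes d1: "\<And>x. (\<psi> has_real_derivative \<psi>' x) (at x)"
    and d2: "\<And>x. (\<psi>' has_real_derivative \<psi>'' x) (at x)"
  shows "generator G (\<lambda>p. \<Sum>l\<in>UNIV. \<psi> (state_prob p l)) p =
    1 / (2 * (vol G)\<^sup>2) *
      (\<Sum>l\<in>UNIV. \<psi>'' (state_prob p l) * (state_prob p l * (drift G l - avg (drift G) p))\<^sup>2)
    + (\<integral>h. (\<Sum>l\<in>UNIV. \<psi> (state_prob (jump_target G p h) l)) - (\<Sum>l\<in>UNIV. \<psi> (state_prob p l)) \<partial>levy_mix G p)
    - (\<Sum>l\<in>UNIV. \<psi>' (state_prob p l) * (state_prob p l * (jump_rate G l - avg (jump_rate G) p)))"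
proof -
  let ?u = "\<lambda>p :: real ^ 'l. \<Sum>l\<in>UNIV. \<psi> (state_prob p l)"
  have p1: "partial_deriv k ?u = (\<lambda>p. \<Sum>l\<in>UNIV. state_coord l k * \<psi>' (state_prob p l))" for k
    using partial_deriv_state_prob_sum[OF d1, of k "\<lambda>_. 1"] by simp
  have p2: "partial_deriv i (partial_deriv k ?u) =
      (\<lambda>p. \<Sum>l\<in>UNIV. state_coord l k * state_coord l i * \<psi>'' (state_prob p l))" for i k
    unfolding p1 by (rule partial_deriv_state_prob_sum[OF d2])
  let ?d = "\<lambda>k. p $ k * (drift G (Some k) - avg (drift G) p)"
  let ?j = "\<lambda>k. p $ k * (jump_rate G (Some k) - avg (jump_rate G) p)"
  have "(\<Sum>i\<in>UNIV. \<Sum>k\<in>UNIV. p $ i * p $ k *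
          (drift G (Some i) - avg (drift G) p) * (drift G (Some k) - avg (drift G) p) *
          partial_deriv i (partial_deriv k ?u) p) =
      (\<Sum>i\<in>UNIV. \<Sum>k\<in>UNIV. \<Sum>l\<in>UNIV. \<psi>'' (state_prob p l) * ((state_coord l i * ?d i) * (state_coord l k * ?d k)))"
    unfolding p2 sum_distrib_left by (intro sum.cong refl) (simp add: mult_ac)
  also have "\<dots> = (\<Sum>i\<in>UNIV. \<Sum>l\<in>UNIV. \<Sum>k\<in>UNIV. \<psi>'' (state_prob p l) * ((state_coord l i * ?d i) * (state_coord l k * ?d k)))"
    by (intro sum.cong refl sum.swap)
  also have "\<dots> = (\<Sum>l\<in>UNIV. \<Sum>i\<in>UNIV. \<Sum>k\<in>UNIV. \<psi>'' (state_prob p l) * ((state_coord l i * ?d i) * (state_coord l k * ?d k)))"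
    by (rule sum.swap)
  also have "\<dots> = (\<Sum>l\<in>UNIV. \<psi>'' (state_prob p l) * ((\<Sum>i\<in>UNIV. state_coord l i * ?d i) * (\<Sum>k\<in>UNIV. state_coord l k * ?d k)))"
    unfolding sum_product by (simp only: sum_distrib_left)
  finally have D: "(\<Sum>i\<in>UNIV. \<Sum>k\<in>UNIV. p $ i * p $ k *
          (drift G (Some i) - avg (drift G) p) * (drift G (Some k) - avg (drift G) p) *
          partial_deriv i (partial_deriv k ?u) p) =
      (\<Sum>l\<in>UNIV. \<psi>'' (state_prob p l) * (state_prob p l * (drift G l - avg (drift G) p))\<^sup>2)"
    unfolding sum_state_coord power2_eq_square .
  have "(\<Sum>k\<in>UNIV. p $ k * (jump_rate G (Some k) - avg (jump_rate G) p) * partial_deriv k ?u p) =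
      (\<Sum>k\<in>UNIV. \<Sum>l\<in>UNIV. \<psi>' (state_prob p l) * (state_coord l k * ?j k))"
    unfolding p1 sum_distrib_left by (intro sum.cong refl) (simp add: mult_ac)
  also have "\<dots> = (\<Sum>l\<in>UNIV. \<psi>' (state_prob p l) * (\<Sum>k\<in>UNIV. state_coord l k * ?j k))"
    unfolding sum_distrib_left by (rule sum.swap)
  finally have J: "(\<Sum>k\<in>UNIV. p $ k * (jump_rate G (Some k) - avg (jump_rate G) p) * partial_deriv k ?u p) =
      (\<Sum>l\<in>UNIV. \<psi>' (state_prob p l) * (state_prob p l * (jump_rate G l - avg (jump_rate G) p)))"
    unfolding sum_state_coord .
  show ?thesis unfolding generator_def D J ..
qed

section \<open>Densities of the Levy measures and the belief after a jump\<close>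

lemma sets_levy_mix [simp, measurable_cong]: "sets (levy_mix G p) = sets borel"
  using sets.sigma_sets_eq[of "borel :: real measure"] by (simp add: levy_mix_def)

lemma space_levy_mix [simp]: "space (levy_mix G p) = UNIV"
  by (simp add: levy_mix_def)

lemma experimentation_game_levy:
  assumes "experimentation_game G"
  shows "sets (levy G l) = sets borel" "finite_measure (levy G l)" "integrable (levy G l) (\<lambda>h. h\<^sup>2)"
  using assms by (auto simp: experimentation_game_def)

text \<open>\<open>measure_of\<close> falls back to the null measure unless the set function is
  countably additive, so this has to be verified first.\<close>

lemma emeasure_levy_mix:
  assumes "experimentation_game G" "A \<in> sets borel"
  shows "emeasure (levy_mix G p) A = (\<Sum>l\<in>UNIV. ennreal (state_prob p l) * emeasure (levy G l) A)"
  unfolding levy_mix_def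
proof (rule emeasure_measure_of)
  show "countably_additive (sets (measure_of UNIV (sets borel)
        (\<lambda>A. \<Sum>l\<in>UNIV. ennreal (state_prob p l) * emeasure (levy G l) A)))
     (\<lambda>A. \<Sum>l\<in>UNIV. ennreal (state_prob p l) * emeasure (levy G l) A)"
  proof (rule countably_additiveI)
    fix A :: "nat \<Rightarrow> real set"
    assume A: "range A \<subseteq> sets (measure_of UNIV (sets borel)
        (\<lambda>A. \<Sum>l\<in>UNIV. ennreal (state_prob p l) * emeasure (levy G l) A))" "disjoint_family A"
    have "(\<Sum>i. emeasure (levy G l) (A i)) = emeasure (levy G l) (\<Union>i. A i)" for l
      using A sets.sigma_sets_eq[of "borel :: real measure"]
      by (intro suminf_emeasure) (auto simp: experimentation_game_levy[OF assms(1)])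
    then show "(\<Sum>i. \<Sum>l\<in>UNIV. ennreal (state_prob p l) * emeasure (levy G l) (A i)) =
        (\<Sum>l\<in>UNIV. ennreal (state_prob p l) * emeasure (levy G l) (\<Union>i. A i))"
      by (simp add: suminf_sum ennreal_suminf_cmult)
  qed
qed (use assms in \<open>auto simp: positive_def\<close>)

lemma finite_measure_levy_mix:
  assumes "experimentation_game G"
  shows "finite_measure (levy_mix G p)"
proof (rule finite_measureI)
  have "emeasure (levy G l) UNIV \<noteq> \<infinity>" for l
    using finite_measure.emeasure_finite[OF experimentation_game_levy(2)[OF assms]] by simp
  then show "emeasure (levy_mix G p) (space (levy_mix G p)) \<noteq> \<infinity>"
    by (auto simp: emeasure_levy_mix[OF assms] ennreal_mult_eq_top_iff)
qed

text \<open>The mixture at the uniform belief dominates all Levy measures.\<close>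

definition uniform_belief :: "real ^ 'l::finite" where
  "uniform_belief = (\<chi> l. 1 / (1 + real CARD('l)))"

definition levy_ref :: "'l::finite game \<Rightarrow> real measure" where
  "levy_ref G = levy_mix G uniform_belief"

text \<open>One choice of density per state, made before any belief is given.
  \<open>jump_target\<close> is instead a Radon-Nikodym derivative chosen anew for each belief,
  which says nothing about measurability in the belief.\<close>

definition levy_density :: "'l::finite game \<Rightarrow> 'l option \<Rightarrow> real \<Rightarrow> real" where
  "levy_density G l = (SOME d. d \<in> borel_measurable borel \<and> (\<forall>h. 0 \<le> d h) \<and>
     levy G l = density (levy_ref G) (\<lambda>h. ennreal (d h)))"

lemma sets_levy_ref [simp, measurable_cong]: "sets (levy_ref G) = sets borel"
  by (simp add: levy_ref_def)

lemma state_prob_uniform_belief_pos: "0 < state_prob (uniform_belief :: real ^ 'l::finite) l"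
  by (auto simp: state_prob_def uniform_belief_def divide_simps split: option.split)

lemma levy_density:
  fixes G :: "'l::{finite,linorder} game"
  assumes G: "experimentation_game G"
  shows "levy_density G l \<in> borel_measurable borel" (is ?A) and "0 \<le> levy_density G l h" (is ?B)
    and "levy G l = density (levy_ref G) (\<lambda>h. ennreal (levy_density G l h))" (is ?C)
proof -
  interpret finite_measure "levy_ref G" unfolding levy_ref_def by (rule finite_measure_levy_mix[OF G])
  have ac: "absolutely_continuous (levy_ref G) (levy G l)"
    unfolding absolutely_continuous_def null_sets_def
    using state_prob_uniform_belief_pos[of l]
    by (auto simp: levy_ref_def emeasure_levy_mix[OF G] experimentation_game_levy[OF G] ennreal_eq_0_iff)
       (metis not_le)
  have sets: "sets (levy G l) = sets (levy_ref G)" by (simp add: experimentation_game_levy[OF G])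
  obtain D where D: "D \<in> borel_measurable (levy_ref G)"
      "AE x in levy_ref G. RN_deriv (levy_ref G) (levy G l) x = ennreal (D x)" "\<And>x. 0 \<le> D x"
    using real_RN_deriv[OF experimentation_game_levy(2)[OF G] ac sets] by blast
  have "levy G l = density (levy_ref G) (\<lambda>h. ennreal (D h))"
    using density_RN_deriv[OF ac sets] D by (subst density_cong[symmetric, OF _ _ D(2)]) auto
  then have "\<exists>d. d \<in> borel_measurable borel \<and> (\<forall>h. 0 \<le> d h) \<and>
     levy G l = density (levy_ref G) (\<lambda>h. ennreal (d h))"
    using D by (intro exI[of _ D]) (simp cong: measurable_cong_sets)
  from someI_ex[OF this] show ?A ?B ?C unfolding levy_density_def by auto
qed

section \<open>Bayes' rule in terms of the fixed densities\<close>

definition mix_density :: "'l::finite game \<Rightarrow> real ^ 'l \<Rightarrow> real \<Rightarrow> real" where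
  "mix_density G p h = (\<Sum>l\<in>UNIV. state_prob p l * levy_density G l h)"

text \<open>Where the mixture density vanishes the quotient is 0 by convention. For beliefs the
  bounds 0 and 1 thus hold at every h, and the sum over states can differ from 1 only on a null set
  of the mixture.\<close>

definition jump_posterior :: "'l::finite game \<Rightarrow> real ^ 'l \<Rightarrow> 'l option \<Rightarrow> real \<Rightarrow> real" where
  "jump_posterior G p l h = state_prob p l * levy_density G l h / mix_density G p h"

lemma measurable_levy_density [measurable]:
  fixes G :: "'l::{finite,linorder} game"
  shows "experimentation_game G \<Longrightarrow> levy_density G l \<in> borel_measurable borel"
  by (rule levy_density)

lemma measurable_mix_density [measurable]:
  fixes G :: "'l::{finite,linorder} game"
  assumes [measurable]: "experimentation_game G"
  shows "(\<lambda>(p, h). mix_density G p h) \<in> borel_measurable (borel \<Otimes>\<^sub>M borel)"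
    and "mix_density G p \<in> borel_measurable borel"
  unfolding mix_density_def[abs_def] by measurable

lemma measurable_jump_posterior [measurable]:
  fixes G :: "'l::{finite,linorder} game"
  assumes [measurable]: "experimentation_game G"
  shows "(\<lambda>(p, h). jump_posterior G p l h) \<in> borel_measurable (borel \<Otimes>\<^sub>M borel)"
    and "jump_posterior G p l \<in> borel_measurable borel"
  unfolding jump_posterior_def[abs_def] by measurable

lemma mix_density_nonneg:
  fixes G :: "'l::{finite,linorder} game"
  assumes "experimentation_game G" "p \<in> beliefs"
  shows "0 \<le> mix_density G p h"
  unfolding mix_density_def
  by (intro sum_nonneg mult_nonneg_nonneg state_prob_nonneg levy_density assms)

lemma jump_posterior_nonneg:
  fixes G :: "'l::{finite,linorder} game"
  assumes "experimentation_game G" "p \<in> beliefs"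
  shows "0 \<le> jump_posterior G p l h"
  unfolding jump_posterior_def
  by (intro divide_nonneg_nonneg mult_nonneg_nonneg mix_density_nonneg state_prob_nonneg levy_density assms)

lemma state_density_le_mix_density:
  fixes G :: "'l::{finite,linorder} game"
  assumes "experimentation_game G" "p \<in> beliefs"
  shows "state_prob p l * levy_density G l h \<le> mix_density G p h"
  unfolding mix_density_def
  by (intro member_le_sum mult_nonneg_nonneg state_prob_nonneg levy_density assms) auto

lemma jump_posterior_le_1:
  fixes G :: "'l::{finite,linorder} game"
  assumes "experimentation_game G" "p \<in> beliefs"
  shows "jump_posterior G p l h \<le> 1"
  unfolding jump_posterior_def
  using state_density_le_mix_density[OF assms] mix_density_nonneg[OF assms, of h]
  by (cases "mix_density G p h = 0") (auto simp: divide_simps)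

text \<open>A vanishing mixture density forces each of its nonnegative summands to vanish, so the
  convention for division by 0 does no harm.\<close>

lemma jump_posterior_mult:
  fixes G :: "'l::{finite,linorder} game"
  assumes "experimentation_game G" "p \<in> beliefs"
  shows "mix_density G p h * jump_posterior G p l h = state_prob p l * levy_density G l h"
  unfolding jump_posterior_def
  using state_density_le_mix_density[OF assms, of l h] mix_density_nonneg[OF assms, of h]
    mult_nonneg_nonneg[OF state_prob_nonneg[OF assms(2)] levy_density(2)[OF assms(1)], of l l h]
  by (cases "mix_density G p h = 0") auto

lemma levy_mix_eq_density:
  fixes G :: "'l::{finite,linorder} game"
  assumes G[measurable]: "experimentation_game G" and p: "p \<in> beliefs"
  shows "levy_mix G p = density (levy_ref G) (\<lambda>h. ennreal (mix_density G p h))"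
proof (rule measure_eqI)
  fix A assume "A \<in> sets (levy_mix G p)"
  then have [measurable]: "A \<in> sets borel" by simp
  have "emeasure (density (levy_ref G) (\<lambda>h. ennreal (mix_density G p h))) A =
      (\<integral>\<^sup>+h. (\<Sum>l\<in>UNIV. ennreal (state_prob p l) * (ennreal (levy_density G l h) * indicator A h)) \<partial>levy_ref G)"
    by (subst emeasure_density)
       (auto intro!: nn_integral_cong simp: mix_density_def sum_distrib_right sum_ennreal[symmetric]
          ennreal_mult levy_density(2)[OF G] state_prob_nonneg[OF p] mult.assoc)
  also have "\<dots> = (\<Sum>l\<in>UNIV. ennreal (state_prob p l) * (\<integral>\<^sup>+h. ennreal (levy_density G l h) * indicator A h \<partial>levy_ref G))"
    by (simp add: nn_integral_sum nn_integral_cmult)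
  also have "\<dots> = (\<Sum>l\<in>UNIV. ennreal (state_prob p l) * emeasure (levy G l) A)"
    unfolding levy_density(3)[OF G] by (simp add: emeasure_density)
  finally show "emeasure (levy_mix G p) A = emeasure (density (levy_ref G) (\<lambda>h. ennreal (mix_density G p h))) A"
    by (simp add: emeasure_levy_mix[OF G])
qed simp

text \<open>Uniqueness of Radon-Nikodym derivatives gives each coordinate, and finitely many null
  sets are discarded. State 0 follows because the posteriors sum to 1 where the mixture density is
  nonzero.\<close>

lemma AE_jump_target:
  fixes G :: "'l::{finite,linorder} game"
  assumes G[measurable]: "experimentation_game G" and p: "p \<in> beliefs"
  shows "AE h in levy_mix G p. \<forall>l. state_prob (jump_target G p h) l = jump_posterior G p l h"
proof -
  interpret finite_measure "levy_mix G p" by (rule finite_measure_levy_mix[OF G])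
  have "density (levy_mix G p) (\<lambda>h. ennreal (jump_posterior G p (Some k) h)) =
      scale_measure (ennreal (p $ k)) (levy G (Some k))" for k
  proof -
    have "density (levy_mix G p) (\<lambda>h. ennreal (jump_posterior G p (Some k) h)) =
        density (levy_ref G) (\<lambda>h. ennreal (mix_density G p h) * ennreal (jump_posterior G p (Some k) h))"
      unfolding levy_mix_eq_density[OF G p] by (rule density_density_eq) measurable
    also have "\<dots> = density (levy_ref G) (\<lambda>h. ennreal (p $ k) * ennreal (levy_density G (Some k) h))"
      by (simp add: ennreal_mult[symmetric] mix_density_nonneg[OF G p] jump_posterior_nonneg[OF G p]
          jump_posterior_mult[OF G p] state_prob_def
          ennreal_mult''[symmetric] levy_density(2)[OF G])
    also have "\<dots> = scale_measure (ennreal (p $ k)) (levy G (Some k))"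
      unfolding levy_density(3)[OF G, of "Some k"]
      by (rule measure_eqI) (auto simp: emeasure_density mult.assoc nn_integral_cmult)
    finally show ?thesis .
  qed
  then have "AE h in levy_mix G p. ennreal (jump_posterior G p (Some k) h) =
      RN_deriv (levy_mix G p) (scale_measure (ennreal (p $ k)) (levy G (Some k))) h" for k
    by (intro RN_deriv_unique) measurable
  then have "AE h in levy_mix G p. \<forall>k. ennreal (jump_posterior G p (Some k) h) =
      RN_deriv (levy_mix G p) (scale_measure (ennreal (p $ k)) (levy G (Some k))) h"
    by (simp add: AE_all_countable)
  moreover have "AE h in levy_mix G p. mix_density G p h \<noteq> 0"
    unfolding levy_mix_eq_density[OF G p] by (subst AE_density) auto
  ultimately show ?thesis
  proof eventually_elim
    case (elim h)
    have *: "jump_target G p h $ k = jump_posterior G p (Some k) h" for k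
      unfolding jump_target_def
      using arg_cong[OF elim(1)[rule_format, of k], of enn2real] jump_posterior_nonneg[OF G p] by simp
    have "(\<Sum>l\<in>UNIV. jump_posterior G p l h) = 1"
      using elim(2) unfolding jump_posterior_def
      by (simp add: sum_divide_distrib[symmetric] mix_density_def)
    then have "jump_posterior G p None h = 1 - (\<Sum>k\<in>UNIV. jump_posterior G p (Some k) h)"
      by (simp add: sum_UNIV_option)
    with * show ?case
      by (auto simp: state_prob_def split: option.split)
  qed
qed

text \<open>Weighting the mixture by the posterior of l recovers \<pi>_l \<nu>_l. Integrals that are
  affine in the posterior thereby reduce to moments of the single Levy measures.\<close>

lemma integral_levy_mix:
  fixes G :: "'l::{finite,linorder} game" and g :: "real \<Rightarrow> real"
  assumes G[measurable]: "experimentation_game G" and p: "p \<in> beliefs"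
    and g: "\<And>l. integrable (levy G l) g"
  shows "has_bochner_integral (levy_mix G p) (\<lambda>h. g h * jump_posterior G p l h)
           (state_prob p l * (\<integral>h. g h \<partial>levy G l))" (is ?A)
    and "has_bochner_integral (levy_mix G p) g (avg (\<lambda>l. \<integral>h. g h \<partial>levy G l) p)" (is ?B)
proof -
  have [measurable]: "g \<in> borel_measurable borel"
    using borel_measurable_integrable[OF g] by (simp add: experimentation_game_levy[OF G] cong: measurable_cong_sets)
  have I: "has_bochner_integral (levy_ref G) (\<lambda>h. levy_density G l h * g h) (\<integral>h. g h \<partial>levy G l)" for l
    using g[of l] unfolding has_bochner_integral_iff levy_density(3)[OF G]
    by (auto simp: integrable_density integral_density levy_density(2)[OF G])
  have "has_bochner_integral (levy_ref G) (\<lambda>h. state_prob p l * (levy_density G l h * g h))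
           (state_prob p l * (\<integral>h. g h \<partial>levy G l))"
    by (rule has_bochner_integral_mult_right) (rule I)
  then show ?A
    unfolding levy_mix_eq_density[OF G p]
    by (intro has_bochner_integral_density)
       (auto simp: mix_density_nonneg[OF G p] jump_posterior_mult[OF G p, symmetric] mult_ac)
  have "has_bochner_integral (levy_ref G) (\<lambda>h. mix_density G p h * g h)
           (\<Sum>l\<in>UNIV. state_prob p l * (\<integral>h. g h \<partial>levy G l))"
    unfolding mix_density_def sum_distrib_right mult.assoc
    by (intro has_bochner_integral_sum has_bochner_integral_mult_right I)
  then show ?B
    unfolding levy_mix_eq_density[OF G p] avg_def
    by (intro has_bochner_integral_density) (auto simp: mix_density_nonneg[OF G p])
qed

section \<open>Drift of the regularised entropy\<close>

definition entropy_test :: "real \<Rightarrow> real ^ 'l::finite \<Rightarrow> real" where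
  "entropy_test e p = (\<Sum>l\<in>UNIV. smooth_entropy e (state_prob p l))"

lemma continuous_smooth_entropy: "0 < e \<Longrightarrow> continuous_on S (smooth_entropy e)"
  by (rule DERIV_continuous_on) (rule DERIV_subset[OF smooth_entropy_has_derivative], auto)

lemma measurable_smooth_entropy [measurable]: "smooth_entropy e \<in> borel_measurable borel"
  unfolding smooth_entropy_def[abs_def] by measurable

lemma C2_entropy_test:
  assumes "0 < e" shows "C2 (entropy_test e)"
  using C2_state_prob_sum[OF smooth_entropy_has_derivative[OF assms] ln_add_sqrt_has_derivative[OF assms]
      continuous_inverse_sqrt_add[OF assms], of "\<lambda>_. 1"]
  by (simp add: entropy_test_def[abs_def])

lemma continuous_entropy_test: "0 < e \<Longrightarrow> continuous_on S (entropy_test e)"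
  unfolding entropy_test_def[abs_def]
  by (intro continuous_on_sum continuous_on_compose2[OF continuous_smooth_entropy[of e UNIV] continuous_state_prob]) auto

lemma entropy_test_bound:
  fixes p :: "real ^ 'l::finite"
  assumes "0 < e" "e \<le> 1" "p \<in> beliefs"
  shows "\<bar>entropy_test e p\<bar> \<le> 4 * (1 + real CARD('l))"
proof -
  have "\<bar>entropy_test e p\<bar> \<le> (\<Sum>l\<in>(UNIV :: 'l option set). 4)"
    unfolding entropy_test_def
    by (intro order_trans[OF sum_abs] sum_mono smooth_entropy_bound state_prob_nonneg state_prob_le_1 assms)
  then show ?thesis by (simp add: card_UNIV_option)
qed

text \<open>With the density moved into the integrand, the measure is fixed and the belief is a mere
  parameter, so joint measurability of the integrand yields measurability in the belief.\<close>

definition entropy_jump :: "'l::finite game \<Rightarrow> real \<Rightarrow> real ^ 'l \<Rightarrow> real" where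
  "entropy_jump G e p = (\<integral>h. mix_density G p h *
     ((\<Sum>l\<in>UNIV. smooth_entropy e (jump_posterior G p l h)) - (\<Sum>l\<in>UNIV. smooth_entropy e (state_prob p l))) \<partial>levy_ref G)"

lemma entropy_jump_eq:
  fixes G :: "'l::{finite,linorder} game"
  assumes [measurable]: "experimentation_game G" and p: "p \<in> beliefs"
  shows "entropy_jump G e p = (\<integral>h. ((\<Sum>l\<in>UNIV. smooth_entropy e (jump_posterior G p l h)) -
      (\<Sum>l\<in>UNIV. smooth_entropy e (state_prob p l))) \<partial>levy_mix G p)"
  unfolding entropy_jump_def levy_mix_eq_density[OF assms]
  by (subst integral_density) (auto simp: mix_density_nonneg[OF assms])

lemma generator_entropy_test:
  fixes G :: "'l::{finite,linorder} game"
  assumes G[measurable]: "experimentation_game G" and p: "p \<in> beliefs" and e: "0 < e"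
  shows "generator G (entropy_test e) p =
    1 / (2 * (vol G)\<^sup>2) *
      (\<Sum>l\<in>UNIV. 1 / sqrt ((state_prob p l)\<^sup>2 + e\<^sup>2) * (state_prob p l * (drift G l - avg (drift G) p))\<^sup>2)
    + entropy_jump G e p
    - (\<Sum>l\<in>UNIV. ln (state_prob p l + sqrt ((state_prob p l)\<^sup>2 + e\<^sup>2)) *
        (state_prob p l * (jump_rate G l - avg (jump_rate G) p)))"
proof -
  have [measurable]: "(\<lambda>h. state_prob (jump_target G p h) l) \<in> borel_measurable borel" for l
  proof -
    have "(\<lambda>h. jump_target G p h $ k) \<in> borel_measurable (levy_mix G p)" for k
      unfolding jump_target_def by simp
    then have [measurable]: "(\<lambda>h. jump_target G p h $ k) \<in> borel_measurable borel" for k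
      by (simp cong: measurable_cong_sets)
    show ?thesis by (cases l) (simp_all add: state_prob_def)
  qed
  have "entropy_jump G e p = (\<integral>h. (\<Sum>l\<in>UNIV. smooth_entropy e (state_prob (jump_target G p h) l)) -
      (\<Sum>l\<in>UNIV. smooth_entropy e (state_prob p l)) \<partial>levy_mix G p)"
    unfolding entropy_jump_eq[OF G p]
  proof (rule integral_cong_AE)
    show "AE h in levy_mix G p.
      (\<Sum>l\<in>UNIV. smooth_entropy e (jump_posterior G p l h)) - (\<Sum>l\<in>UNIV. smooth_entropy e (state_prob p l)) =
      (\<Sum>l\<in>UNIV. smooth_entropy e (state_prob (jump_target G p h) l)) - (\<Sum>l\<in>UNIV. smooth_entropy e (state_prob p l))"
      using AE_jump_target[OF G p] by eventually_elim simp
  qed measurable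
  then show ?thesis
    unfolding entropy_test_def[abs_def]
    by (simp only: generator_state_prob_sum[OF smooth_entropy_has_derivative[OF e] ln_add_sqrt_has_derivative[OF e]])
qed

lemma measurable_entropy_jump [measurable]:
  fixes G :: "'l::{finite,linorder} game"
  assumes G[measurable]: "experimentation_game G"
  shows "entropy_jump G e \<in> borel_measurable borel"
proof -
  interpret finite_measure "levy_ref G" unfolding levy_ref_def by (rule finite_measure_levy_mix[OF G])
  show ?thesis
    unfolding entropy_jump_def[abs_def] by measurable
qed

lemma measurable_generator_entropy_test:
  fixes G :: "'l::{finite,linorder} game"
  assumes G[measurable]: "experimentation_game G" and e: "0 < e"
  shows "generator G (entropy_test e) \<in> borel_measurable (restrict_space borel beliefs)"
proof -
  have "(\<lambda>p. 1 / (2 * (vol G)\<^sup>2) *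
      (\<Sum>l\<in>UNIV. 1 / sqrt ((state_prob p l)\<^sup>2 + e\<^sup>2) * (state_prob p l * (drift G l - avg (drift G) p))\<^sup>2)
    + entropy_jump G e p
    - (\<Sum>l\<in>UNIV. ln (state_prob p l + sqrt ((state_prob p l)\<^sup>2 + e\<^sup>2)) *
        (state_prob p l * (jump_rate G l - avg (jump_rate G) p)))) \<in> borel_measurable borel"
    unfolding avg_def by measurable
  then show ?thesis
    by (subst measurable_cong[OF generator_entropy_test[OF G _ e]])
       (auto simp: space_restrict_space intro: measurable_restrict_space1)
qed

section \<open>Upper and lower bounds for the drift of the entropy\<close>

lemma avg_le_sum:
  assumes "p \<in> beliefs" "\<And>l. 0 \<le> a l"
  shows "avg a p \<le> (\<Sum>l\<in>UNIV. a l)"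
  unfolding avg_def
  using state_prob_nonneg[OF assms(1)] state_prob_le_1[OF assms(1)] assms(2)
  by (intro sum_mono mult_left_le_one_le) auto

lemma integrable_levy:
  assumes "experimentation_game G"
  shows "integrable (levy G l) (\<lambda>h. h)" "integrable (levy G l) (\<lambda>h. c :: real)"
proof -
  interpret finite_measure "levy G l" by (rule experimentation_game_levy[OF assms])
  show "integrable (levy G l) (\<lambda>h. c)" by simp
  have "(\<lambda>h. h) \<in> borel_measurable (levy G l)"
    by (simp add: experimentation_game_levy(1)[OF assms] cong: measurable_cong_sets)
  then show "integrable (levy G l) (\<lambda>h. h)"
    by (rule square_integrable_imp_integrable) (rule experimentation_game_levy(3)[OF assms])
qed

text \<open>Diffusion and compensator are continuous on a compact set; the jump integrand is bounded
  and the mass of the mixture is at most the total mass of all Levy measures. The constant may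
  depend on e: it only serves integrability over a finite horizon.\<close>

lemma generator_entropy_test_bounded:
  fixes G :: "'l::{finite,linorder} game"
  assumes G[measurable]: "experimentation_game G" and e: "0 < e" "e \<le> 1"
  obtains C where "\<And>p. p \<in> beliefs \<Longrightarrow> \<bar>generator G (entropy_test e) p\<bar> \<le> C"
proof -
  let ?F = "\<lambda>p. 1 / (2 * (vol G)\<^sup>2) *
      (\<Sum>l\<in>UNIV. 1 / sqrt ((state_prob p l)\<^sup>2 + e\<^sup>2) * (state_prob p l * (drift G l - avg (drift G) p))\<^sup>2)
    - (\<Sum>l\<in>UNIV. ln (state_prob p l + sqrt ((state_prob p l)\<^sup>2 + e\<^sup>2)) *
        (state_prob p l * (jump_rate G l - avg (jump_rate G) p)))"
  have "(state_prob p l)\<^sup>2 + e\<^sup>2 \<noteq> 0" for p l using e by (simp add: sum_power2_eq_zero_iff)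
  moreover have "state_prob p l + sqrt ((state_prob p l)\<^sup>2 + e\<^sup>2) \<noteq> 0" for p l
    using add_sqrt_pos[OF e(1), of "state_prob p l"] by linarith
  ultimately have "continuous_on beliefs ?F"
    unfolding avg_def by (intro continuous_intros) auto
  then have "bounded (?F ` beliefs)"
    by (intro compact_imp_bounded compact_continuous_image compact_beliefs)
  then obtain C where C: "\<And>p. p \<in> beliefs \<Longrightarrow> \<bar>?F p\<bar> \<le> C"
    unfolding bounded_iff by auto
  \<comment> \<open>Twice the bound 4 on \<open>smooth_entropy\<close>, for each of the 1 + L
    states.\<close>
  let ?c = "8 * (1 + real CARD('l))"
  let ?D = "\<Sum>l\<in>UNIV. (\<integral>h. ?c \<partial>levy G l)"
  have "\<bar>entropy_jump G e p\<bar> \<le> ?D" if p: "p \<in> beliefs" for p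
  proof -
    have "\<bar>\<Sum>l\<in>UNIV. smooth_entropy e (jump_posterior G p l h)\<bar> \<le> (\<Sum>l\<in>(UNIV :: 'l option set). 4)" for h
      by (intro order_trans[OF sum_abs] sum_mono smooth_entropy_bound jump_posterior_nonneg jump_posterior_le_1 e p G)
    then have J: "\<bar>\<Sum>l\<in>UNIV. smooth_entropy e (jump_posterior G p l h)\<bar> \<le> 4 * (1 + real CARD('l))" for h
      by (simp add: card_UNIV_option mult.commute)
    have P: "\<bar>\<Sum>l\<in>UNIV. smooth_entropy e (state_prob p l)\<bar> \<le> 4 * (1 + real CARD('l))"
      using entropy_test_bound[OF e p] by (simp add: entropy_test_def)
    have *: "\<bar>(\<Sum>l\<in>UNIV. smooth_entropy e (jump_posterior G p l h)) -
      (\<Sum>l\<in>UNIV. smooth_entropy e (state_prob p l))\<bar> \<le> ?c" for h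
      using order_trans[OF abs_triangle_ineq4 add_mono[OF J[of h] P]] by simp
    interpret finite_measure "levy_mix G p" by (rule finite_measure_levy_mix[OF G])
    have "\<bar>entropy_jump G e p\<bar> \<le> (\<integral>h. \<bar>(\<Sum>l\<in>UNIV. smooth_entropy e (jump_posterior G p l h)) -
          (\<Sum>l\<in>UNIV. smooth_entropy e (state_prob p l))\<bar> \<partial>levy_mix G p)"
      unfolding entropy_jump_eq[OF G p] by (rule integral_abs_bound)
    also have "\<dots> \<le> (\<integral>h. ?c \<partial>levy_mix G p)"
      by (rule integral_mono') (use * in simp_all)
    also have "\<dots> = avg (\<lambda>l. \<integral>h. ?c \<partial>levy G l) p"
      using integral_levy_mix(2)[OF G p, of "\<lambda>_. ?c"] integrable_levy[OF G] by (simp add: has_bochner_integral_iff)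
    also have "\<dots> \<le> ?D" by (rule avg_le_sum[OF p]) simp
    finally show ?thesis .
  qed
  then have "\<bar>generator G (entropy_test e) p\<bar> \<le> C + ?D" if "p \<in> beliefs" for p
    using C[OF that] generator_entropy_test[OF G that e(1)] that by fastforce
  then show ?thesis using that by blast
qed

text \<open>Dominates the second moment of every Levy measure and of every mixture; the summand 1
  keeps it positive when there are no jumps.\<close>

definition jump_moment_bound :: "'l::finite game \<Rightarrow> real" where
  "jump_moment_bound G = 1 + (\<Sum>l\<in>UNIV. \<integral>h. h\<^sup>2 \<partial>levy G l)"

lemma jump_moment_bound_pos: "0 < jump_moment_bound G"
  unfolding jump_moment_bound_def by (intro add_pos_nonneg sum_nonneg integral_nonneg) auto

text \<open>Cauchy--Schwarz, with the optimal multiplier \<open>\<theta>\<close> made explicit so that only affine functions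
  of the posterior have to be integrated.\<close>
lemma smooth_entropy_jump_lower:
  fixes G :: "'l::{finite,linorder} game"
  defines "\<eta> \<equiv> \<lambda>l. \<integral>h. h \<partial>levy G l"
  assumes G[measurable]: "experimentation_game G" and p: "p \<in> beliefs" and e: "0 < e" "e \<le> 1"
  shows "(state_prob p l * (\<eta> l - avg \<eta> p))\<^sup>2 / (2 * ((2 * state_prob p l + e) * jump_moment_bound G)) \<le>
     (\<integral>h. smooth_entropy e (jump_posterior G p l h) - smooth_entropy e (state_prob p l) \<partial>levy_mix G p)
     - ln (state_prob p l + sqrt ((state_prob p l)\<^sup>2 + e\<^sup>2)) * (state_prob p l * (jump_rate G l - avg (jump_rate G) p))"
proof -
  let ?\<pi> = "state_prob p l" and ?J = "jump_posterior G p l" and ?M = "jump_moment_bound G"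
  let ?D = "ln (?\<pi> + sqrt (?\<pi>\<^sup>2 + e\<^sup>2))"
  define m2 where "m2 = (\<lambda>l. \<integral>h. h\<^sup>2 \<partial>levy G l)"
  define X where "X = ?\<pi> * (\<eta> l - avg \<eta> p)"
  \<comment> \<open>An upper bound for the integral of (\<pi> + J + e) h^2 against the mixture, the
    weight being the one from \<open>smooth_entropy_bregman\<close>.\<close>
  define W where "W = (2 * ?\<pi> + e) * ?M"
  \<comment> \<open>The maximiser of \<theta> X - \<theta>^2 W / 2, whose maximum is X^2 / (2
    W).\<close>
  define \<theta> where "\<theta> = X / W"
  interpret finite_measure "levy_mix G p" by (rule finite_measure_levy_mix[OF G])
  have \<pi>: "0 \<le> ?\<pi>" by (rule state_prob_nonneg[OF p])
  have W: "0 < W" unfolding W_def using \<pi> e jump_moment_bound_pos[of G] by simp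
  note I1 = integral_levy_mix[OF G p integrable_levy(2)[OF G], of 1]
  note Ih = integral_levy_mix[OF G p integrable_levy(1)[OF G]]
  note I2 = integral_levy_mix[OF G p experimentation_game_levy(3)[OF G]]
  have rate: "(\<integral>h. 1 \<partial>levy G l) = jump_rate G l" for l
    by (simp add: jump_rate_def sets_eq_imp_space_eq[OF experimentation_game_levy(1)[OF G]])
  have lower: "has_bochner_integral (levy_mix G p)
      (\<lambda>h. \<theta> * (h * ?J h - ?\<pi> * h) - \<theta>\<^sup>2 / 2 * (h\<^sup>2 * ?J h + (?\<pi> + e) * h\<^sup>2))
      (\<theta> * (?\<pi> * \<eta> l - ?\<pi> * avg \<eta> p) - \<theta>\<^sup>2 / 2 * (?\<pi> * m2 l + (?\<pi> + e) * avg m2 p))"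
    unfolding \<eta>_def m2_def
    by (intro has_bochner_integral_diff has_bochner_integral_add has_bochner_integral_mult_right Ih I2)
  have S: "has_bochner_integral (levy_mix G p) (\<lambda>h. smooth_entropy e (?J h) - smooth_entropy e ?\<pi>)
      (\<integral>h. smooth_entropy e (?J h) - smooth_entropy e ?\<pi> \<partial>levy_mix G p)"
  proof (intro has_bochner_integral_integrable integrable_const_bound[where B = 8] AE_I2)
    fix h
    show "norm (smooth_entropy e (?J h) - smooth_entropy e ?\<pi>) \<le> 8"
      using smooth_entropy_bound[OF e jump_posterior_nonneg[OF G p] jump_posterior_le_1[OF G p], of l h]
        smooth_entropy_bound[OF e \<pi> state_prob_le_1[OF p]] by simp
  qed measurable
  \<comment> \<open>The integrand is the Bregman divergence from \<pi> to J, and the subtracted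
    integral is exactly the compensator term of the generator.\<close>
  have upper: "has_bochner_integral (levy_mix G p)
      (\<lambda>h. (smooth_entropy e (?J h) - smooth_entropy e ?\<pi>) - ?D * (1 * ?J h - ?\<pi> * 1))
      ((\<integral>h. smooth_entropy e (?J h) - smooth_entropy e ?\<pi> \<partial>levy_mix G p) -
        ?D * (?\<pi> * jump_rate G l - ?\<pi> * avg (jump_rate G) p))"
    using I1 unfolding rate
    by (intro has_bochner_integral_diff has_bochner_integral_mult_right S)
  have "\<theta> * (h * ?J h - ?\<pi> * h) - \<theta>\<^sup>2 / 2 * (h\<^sup>2 * ?J h + (?\<pi> + e) * h\<^sup>2) \<le>
      (smooth_entropy e (?J h) - smooth_entropy e ?\<pi>) - ?D * (1 * ?J h - ?\<pi> * 1)" for h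
  proof -
    let ?a = "?J h - ?\<pi>" and ?w = "?\<pi> + ?J h + e"
    have w: "0 < ?w" using \<pi> jump_posterior_nonneg[OF G p, of l h] e by linarith
    \<comment> \<open>Completing the square bounds a^2 / (2 w) from below by an expression affine in
      the posterior, for any \<theta>.\<close>
    have "0 \<le> (?a - \<theta> * h * ?w)\<^sup>2 / (2 * ?w)" using w by simp
    also have "\<dots> = ?a\<^sup>2 / (2 * ?w) - (\<theta> * h * ?a - \<theta>\<^sup>2 * h\<^sup>2 * ?w / 2)"
      using w by (simp add: field_simps power2_eq_square)
    finally have "\<theta> * h * ?a - \<theta>\<^sup>2 * h\<^sup>2 * ?w / 2 \<le> ?a\<^sup>2 / (2 * ?w)" by simp
    with smooth_entropy_bregman[OF e(1) \<pi> jump_posterior_nonneg[OF G p], of l h]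
    show ?thesis by (simp add: algebra_simps add_divide_distrib)
  qed
  then have "(\<integral>h. \<theta> * (h * ?J h - ?\<pi> * h) - \<theta>\<^sup>2 / 2 * (h\<^sup>2 * ?J h + (?\<pi> + e) * h\<^sup>2) \<partial>levy_mix G p) \<le>
      (\<integral>h. (smooth_entropy e (?J h) - smooth_entropy e ?\<pi>) - ?D * (1 * ?J h - ?\<pi> * 1) \<partial>levy_mix G p)"
    using lower upper unfolding has_bochner_integral_iff by (intro integral_mono) blast+
  then have main: "\<theta> * (?\<pi> * \<eta> l - ?\<pi> * avg \<eta> p) - \<theta>\<^sup>2 / 2 * (?\<pi> * m2 l + (?\<pi> + e) * avg m2 p) \<le>
      (\<integral>h. smooth_entropy e (?J h) - smooth_entropy e ?\<pi> \<partial>levy_mix G p) -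
        ?D * (?\<pi> * jump_rate G l - ?\<pi> * avg (jump_rate G) p)"
    unfolding has_bochner_integral_integral_eq[OF lower] has_bochner_integral_integral_eq[OF upper] .
  have m2: "0 \<le> m2 k" for k unfolding m2_def by simp
  have "m2 l \<le> ?M"
    using member_le_sum[of l UNIV m2] m2 by (simp add: jump_moment_bound_def m2_def)
  moreover have "avg m2 p \<le> ?M"
    using avg_le_sum[OF p, of m2] m2 by (simp add: jump_moment_bound_def m2_def)
  ultimately have "?\<pi> * m2 l + (?\<pi> + e) * avg m2 p \<le> ?\<pi> * ?M + (?\<pi> + e) * ?M"
    using \<pi> e by (intro add_mono mult_left_mono) auto
  also have "\<dots> = W" by (simp add: W_def algebra_simps)
  finally have "\<theta>\<^sup>2 / 2 * (?\<pi> * m2 l + (?\<pi> + e) * avg m2 p) \<le> \<theta>\<^sup>2 / 2 * W"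
    by (intro mult_left_mono) auto
  moreover have "X\<^sup>2 / (2 * W) = \<theta> * X - \<theta>\<^sup>2 / 2 * W"
    using W by (simp add: \<theta>_def field_simps power2_eq_square)
  moreover have "\<theta> * (?\<pi> * \<eta> l - ?\<pi> * avg \<eta> p) = \<theta> * X" by (simp add: X_def algebra_simps)
  ultimately have "X\<^sup>2 / (2 * W) \<le> (\<integral>h. smooth_entropy e (?J h) - smooth_entropy e ?\<pi> \<partial>levy_mix G p) -
        ?D * (?\<pi> * jump_rate G l - ?\<pi> * avg (jump_rate G) p)"
    using main by linarith
  then show ?thesis unfolding X_def W_def by (simp add: algebra_simps)
qed

text \<open>A regularised \<open>payoff_variance\<close>: for beliefs the weight \<pi>^2 / (\<pi> +
  e) increases to \<pi> as e decreases to 0.\<close>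

definition smooth_variance :: "'l::finite game \<Rightarrow> real \<Rightarrow> real ^ 'l \<Rightarrow> real" where
  "smooth_variance G e p =
     (\<Sum>l\<in>UNIV. (state_prob p l)\<^sup>2 / (state_prob p l + e) * (mean_payoff G l - exp_payoff G p)\<^sup>2)"

text \<open>The first entry is the diffusion coefficient. The second comes from the jump estimate,
  whose denominator 2 (2 \<pi> + e) M is at most 4 (\<pi> + e) M. The last halving pays for (x +
  y)^2 \<le> 2 (x^2 + y^2).\<close>

definition learning_rate :: "'l::finite game \<Rightarrow> real" where
  "learning_rate G = min (1 / (2 * (vol G)\<^sup>2)) (1 / (4 * jump_moment_bound G)) / 2"

lemma learning_rate_pos: "experimentation_game G \<Longrightarrow> 0 < learning_rate G"
  using jump_moment_bound_pos[of G] by (simp add: learning_rate_def experimentation_game_def)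

text \<open>A state's mean payoff deviates from the average by x + y, with x from the drift and y
  from the mean jump. The diffusion part controls x^2 and the jump part y^2, which suffices even if
  x and y have opposite signs.\<close>

lemma generator_entropy_test_lower:
  fixes G :: "'l::{finite,linorder} game"
  assumes G[measurable]: "experimentation_game G" and p: "p \<in> beliefs" and e: "0 < e" "e \<le> 1"
  shows "learning_rate G * smooth_variance G e p \<le> generator G (entropy_test e) p"
proof -
  define \<eta> where "\<eta> = (\<lambda>l. \<integral>h. h \<partial>levy G l)"
  let ?\<pi> = "state_prob p" and ?M = "jump_moment_bound G"
  let ?x = "\<lambda>l. drift G l - avg (drift G) p" and ?y = "\<lambda>l. \<eta> l - avg \<eta> p"
  define S where "S = (\<lambda>l. (\<integral>h. smooth_entropy e (jump_posterior G p l h) - smooth_entropy e (?\<pi> l) \<partial>levy_mix G p))"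
  define T where "T = (\<lambda>l. ln (?\<pi> l + sqrt ((?\<pi> l)\<^sup>2 + e\<^sup>2)) * (?\<pi> l * (jump_rate G l - avg (jump_rate G) p)))"
  interpret finite_measure "levy_mix G p" by (rule finite_measure_levy_mix[OF G])
  have "integrable (levy_mix G p) (\<lambda>h. smooth_entropy e (jump_posterior G p l h) - smooth_entropy e (?\<pi> l))" for l
  proof (intro integrable_const_bound[where B = 8] AE_I2)
    fix h
    show "norm (smooth_entropy e (jump_posterior G p l h) - smooth_entropy e (?\<pi> l)) \<le> 8"
      using smooth_entropy_bound[OF e jump_posterior_nonneg[OF G p] jump_posterior_le_1[OF G p], of l h]
        smooth_entropy_bound[OF e state_prob_nonneg[OF p] state_prob_le_1[OF p], of l] by simp
  qed measurable
  then have jump: "entropy_jump G e p = (\<Sum>l\<in>UNIV. S l)"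
    unfolding entropy_jump_eq[OF G p] sum_subtractf[symmetric] S_def by (rule Bochner_Integration.integral_sum)
  have split: "mean_payoff G l - exp_payoff G p = ?x l + ?y l" for l
    by (simp add: mean_payoff_def exp_payoff_def avg_def \<eta>_def sum.distrib algebra_simps)
  have "learning_rate G * ((?\<pi> l)\<^sup>2 / (?\<pi> l + e) * (mean_payoff G l - exp_payoff G p)\<^sup>2) \<le>
      1 / (2 * (vol G)\<^sup>2) * (1 / sqrt ((?\<pi> l)\<^sup>2 + e\<^sup>2) * (?\<pi> l * ?x l)\<^sup>2) + (S l - T l)" for l
  proof -
    let ?a = "1 / (2 * (vol G)\<^sup>2)" and ?b = "1 / (4 * ?M)" and ?q = "(?\<pi> l)\<^sup>2 / (?\<pi> l + e)"
    have \<pi>: "0 \<le> ?\<pi> l" by (rule state_prob_nonneg[OF p])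
    have q: "0 \<le> ?q" using \<pi> e by simp
    have "learning_rate G * (?q * (?x l + ?y l)\<^sup>2) = (min ?a ?b * ?q) * ((?x l + ?y l)\<^sup>2 / 2)"
    proof -
      have "a / 2 * (q * z) = (a * q) * (z / 2)" for a q z :: real by simp
      then show ?thesis unfolding learning_rate_def .
    qed
    also have "\<dots> \<le> (min ?a ?b * ?q) * ((?x l)\<^sup>2 + (?y l)\<^sup>2)"
    proof (rule mult_left_mono)
      show "(?x l + ?y l)\<^sup>2 / 2 \<le> (?x l)\<^sup>2 + (?y l)\<^sup>2"
        using sum_squares_bound[of "?x l" "?y l"] by (simp add: power2_sum)
      show "0 \<le> min ?a ?b * ?q"
        using q jump_moment_bound_pos[of G] by (intro mult_nonneg_nonneg) auto
    qed
    also have "\<dots> = min ?a ?b * (?q * (?x l)\<^sup>2) + min ?a ?b * (?q * (?y l)\<^sup>2)"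
      by (simp only: distrib_left mult.assoc)
    also have "\<dots> \<le> ?a * (?q * (?x l)\<^sup>2) + ?b * (?q * (?y l)\<^sup>2)"
      by (intro add_mono mult_right_mono mult_nonneg_nonneg q) auto
    also have "\<dots> \<le> ?a * (1 / sqrt ((?\<pi> l)\<^sup>2 + e\<^sup>2) * (?\<pi> l * ?x l)\<^sup>2) + (S l - T l)"
    proof (intro add_mono mult_left_mono)
      show "?q * (?x l)\<^sup>2 \<le> 1 / sqrt ((?\<pi> l)\<^sup>2 + e\<^sup>2) * (?\<pi> l * ?x l)\<^sup>2"
      proof -
        have "sqrt ((?\<pi> l)\<^sup>2 + e\<^sup>2) \<le> ?\<pi> l + e"
          using sqrt_sum_squares_le_sum[of "?\<pi> l" e] \<pi> e by simp
        moreover have "0 < sqrt ((?\<pi> l)\<^sup>2 + e\<^sup>2)" using e by (simp add: sum_power2_gt_zero_iff)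
        ultimately have "1 / (?\<pi> l + e) \<le> 1 / sqrt ((?\<pi> l)\<^sup>2 + e\<^sup>2)"
          by (intro divide_left_mono) (use \<pi> e in auto)
        from mult_right_mono[OF this, of "(?\<pi> l * ?x l)\<^sup>2"] show ?thesis
          by (simp add: power_mult_distrib)
      qed
      have "?b * (?q * (?y l)\<^sup>2) \<le> (?\<pi> l * ?y l)\<^sup>2 / (2 * ((2 * ?\<pi> l + e) * ?M))"
      proof -
        \<comment> \<open>Enlarging e to 2 e in the denominator of the jump estimate makes it a
          multiple of \<pi> + e, the denominator used for the diffusion part.\<close>
        have "?b * (?q * (?y l)\<^sup>2) = (?\<pi> l * ?y l)\<^sup>2 / (2 * ((2 * ?\<pi> l + 2 * e) * ?M))"
        proof -
          have "1 / (4 * M) * (a / (x + e) * y) = a * y / (2 * ((2 * x + 2 * e) * M))" for M a x e y :: real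
            by (simp add: algebra_simps)
          then show ?thesis unfolding power_mult_distrib .
        qed
        also have "\<dots> \<le> (?\<pi> l * ?y l)\<^sup>2 / (2 * ((2 * ?\<pi> l + e) * ?M))"
          using \<pi> e jump_moment_bound_pos[of G]
          by (intro divide_left_mono mult_left_mono mult_right_mono mult_pos_pos) auto
        finally show ?thesis .
      qed
      also have "(?\<pi> l * ?y l)\<^sup>2 / (2 * ((2 * ?\<pi> l + e) * ?M)) \<le> S l - T l"
        using smooth_entropy_jump_lower[OF G p e, of l] unfolding S_def T_def \<eta>_def .
      finally show "?b * (?q * (?y l)\<^sup>2) \<le> S l - T l" .
    qed simp
    finally show ?thesis unfolding split .
  qed
  then have "(\<Sum>l\<in>UNIV. learning_rate G * ((?\<pi> l)\<^sup>2 / (?\<pi> l + e) * (mean_payoff G l - exp_payoff G p)\<^sup>2)) \<le>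
      (\<Sum>l\<in>UNIV. 1 / (2 * (vol G)\<^sup>2) * (1 / sqrt ((?\<pi> l)\<^sup>2 + e\<^sup>2) * (?\<pi> l * ?x l)\<^sup>2) + (S l - T l))"
    by (intro sum_mono)
  then show ?thesis
    unfolding generator_entropy_test[OF G p e(1)] jump smooth_variance_def T_def
    by (simp add: sum.distrib sum_subtractf sum_distrib_left)
qed

section \<open>Payoff shortfall of reasonable strategies\<close>

definition expected_gain :: "'l::finite game \<Rightarrow> real ^ 'l \<Rightarrow> real" where
  "expected_gain G = avg (\<lambda>l. max 0 (mean_payoff G l - safe G))"

definition expected_loss :: "'l::finite game \<Rightarrow> real ^ 'l \<Rightarrow> real" where
  "expected_loss G = avg (\<lambda>l. max 0 (safe G - mean_payoff G l))"

definition payoff_variance :: "'l::finite game \<Rightarrow> real ^ 'l \<Rightarrow> real" where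
  "payoff_variance G p = (\<Sum>l\<in>UNIV. state_prob p l * (mean_payoff G l - exp_payoff G p)\<^sup>2)"

section \<open>Averages over states and the gain-loss decomposition\<close>

lemma avg_const: "avg (\<lambda>_. c) p = c"
  unfolding avg_def by (simp only: sum_distrib_right[symmetric] sum_state_prob mult_1)

lemma avg_diff: "avg (\<lambda>l. a l - b l) p = avg a p - avg b p"
  unfolding avg_def by (simp only: right_diff_distrib sum_subtractf)

lemma avg_add: "avg (\<lambda>l. a l + b l) p = avg a p + avg b p"
  unfolding avg_def by (simp only: distrib_left sum.distrib)

lemma avg_cmult: "avg (\<lambda>l. c * a l) p = c * avg a p"
  unfolding avg_def by (simp only: sum_distrib_left mult.left_commute)

lemma avg_nonneg:
  assumes "p \<in> beliefs" "\<And>l. 0 \<le> a l"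
  shows "0 \<le> avg a p"
  unfolding avg_def by (rule sum_nonneg) (rule mult_nonneg_nonneg[OF state_prob_nonneg[OF assms(1)] assms(2)])

lemma avg_square_deviation:
  "avg (\<lambda>l. (a l - c)\<^sup>2) p = avg (\<lambda>l. (a l)\<^sup>2) p - 2 * c * avg a p + c\<^sup>2"
proof -
  have "(a l - c)\<^sup>2 = (a l)\<^sup>2 - 2 * c * a l + c\<^sup>2" for l
    by (simp add: power2_diff)
  then show ?thesis by (simp only: avg_add avg_diff avg_cmult avg_const)
qed

lemma avg_square_ge:
  assumes "p \<in> beliefs" shows "(avg a p)\<^sup>2 \<le> avg (\<lambda>l. (a l)\<^sup>2) p"
proof -
  have "0 \<le> avg (\<lambda>l. (a l - avg a p)\<^sup>2) p" by (intro avg_nonneg assms) simp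
  then show ?thesis unfolding avg_square_deviation by (simp add: power2_eq_square algebra_simps)
qed

lemma avg_surplus:
  "avg (\<lambda>l. mean_payoff G l - safe G) p = expected_gain G p - expected_loss G p"
proof -
  have "avg (\<lambda>l. mean_payoff G l - safe G) p =
      avg (\<lambda>l. max 0 (mean_payoff G l - safe G) - max 0 (safe G - mean_payoff G l)) p"
    by (intro arg_cong[where f = "\<lambda>a. avg a p"] ext) (simp add: max_def)
  then show ?thesis by (simp only: avg_diff expected_gain_def expected_loss_def)
qed

lemma exp_payoff_eq: "exp_payoff G p = safe G + (expected_gain G p - expected_loss G p)"
  using avg_surplus[of G p] by (simp add: avg_diff avg_const exp_payoff_def)

lemma payoff_rate_eq:
  "- payoff_rate G \<kappa> p = (1 - \<kappa> p) * expected_gain G p + \<kappa> p * expected_loss G p"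
proof -
  have "full_info_payoff G p = avg (\<lambda>l. safe G + max 0 (mean_payoff G l - safe G)) p"
    unfolding full_info_payoff_def
    by (intro arg_cong[where f = "\<lambda>a. avg a p"] ext) (simp add: max_def)
  then have "full_info_payoff G p = safe G + expected_gain G p"
    by (simp only: avg_add avg_const expected_gain_def)
  then show ?thesis unfolding payoff_rate_def exp_payoff_eq by (simp add: algebra_simps)
qed

text \<open>Gain a and loss b are never both positive in one state, so (a - b)^2 = a^2 + b^2. Jensen
  bounds the mean of this below by A^2 + B^2, and subtracting (A - B)^2 leaves 2 A B.\<close>

lemma gain_loss_le_variance:
  assumes p: "p \<in> beliefs"
  shows "2 * (expected_gain G p * expected_loss G p) \<le> payoff_variance G p"
proof -
  let ?a = "\<lambda>l. max 0 (mean_payoff G l - safe G)" and ?b = "\<lambda>l. max 0 (safe G - mean_payoff G l)"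
  let ?y = "\<lambda>l. mean_payoff G l - safe G" and ?D = "expected_gain G p - expected_loss G p"
  have "payoff_variance G p = avg (\<lambda>l. (?y l - ?D)\<^sup>2) p"
    unfolding payoff_variance_def avg_def exp_payoff_eq by (simp add: algebra_simps)
  also have "\<dots> = avg (\<lambda>l. (?y l)\<^sup>2) p - ?D\<^sup>2"
    by (simp only: avg_square_deviation avg_surplus) (simp add: power2_eq_square)
  also have "avg (\<lambda>l. (?y l)\<^sup>2) p = avg (\<lambda>l. (?a l)\<^sup>2 + (?b l)\<^sup>2) p"
    by (intro arg_cong[where f = "\<lambda>a. avg a p"] ext) (simp add: max_def power2_commute)
  also have "\<dots> = avg (\<lambda>l. (?a l)\<^sup>2) p + avg (\<lambda>l. (?b l)\<^sup>2) p"
    by (rule avg_add)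
  finally show ?thesis
    using avg_square_ge[OF p, of ?a] avg_square_ge[OF p, of ?b]
    unfolding expected_gain_def expected_loss_def by (simp add: power2_diff)
qed

lemma avg_eq_0_iff:
  assumes "p \<in> beliefs" "\<And>l. 0 \<le> a l"
  shows "avg a p = 0 \<longleftrightarrow> (\<forall>l. 0 < a l \<longrightarrow> state_prob p l = 0)"
proof -
  have "avg a p = 0 \<longleftrightarrow> (\<forall>l\<in>UNIV. state_prob p l * a l = 0)"
    unfolding avg_def
    by (intro sum_nonneg_eq_0_iff mult_nonneg_nonneg state_prob_nonneg assms) auto
  then show ?thesis using assms(2) by (auto simp: less_le)
qed

lemma beliefs_below_iff: "p \<in> beliefs_below G \<longleftrightarrow> p \<in> beliefs \<and> expected_gain G p = 0"
  using avg_eq_0_iff[of p "\<lambda>l. max 0 (mean_payoff G l - safe G)"]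
  by (auto simp: beliefs_below_def expected_gain_def less_max_iff_disj)

lemma beliefs_above_iff: "p \<in> beliefs_above G \<longleftrightarrow> p \<in> beliefs \<and> expected_loss G p = 0"
  using avg_eq_0_iff[of p "\<lambda>l. max 0 (safe G - mean_payoff G l)"]
  by (auto simp: beliefs_above_def expected_loss_def less_max_iff_disj)

lemma continuous_avg: "continuous_on S (avg a)"
  unfolding avg_def[abs_def] by (intro continuous_intros)

lemma compact_positive_lower_bound:
  fixes g :: "'a::topological_space \<Rightarrow> real"
  assumes "compact K" "continuous_on K g" "\<And>x. x \<in> K \<Longrightarrow> 0 < g x"
  obtains c where "0 < c" "\<And>x. x \<in> K \<Longrightarrow> c \<le> g x"
proof (cases "K = {}")
  case False
  then obtain x where "x \<in> K" "\<And>y. y \<in> K \<Longrightarrow> g x \<le> g y"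
    using continuous_attains_inf[OF assms(1) _ assms(2)] by blast
  then show ?thesis using that[of "g x"] assms(3) by blast
qed (use that[of 1] in simp)

lemma strategies_continuous: "\<kappa> \<in> strategies \<Longrightarrow> continuous_on beliefs \<kappa>"
  by (auto simp: strategies_def intro: lipschitz_on_continuous_on)

text \<open>Near the face where the gain (loss) vanishes, the shortfall equals the gain (loss), while the
  other factor of the product is bounded away from 0.\<close>
lemma reasonable_shortfall_bound:
  fixes G :: "'l::finite game"
  assumes r: "reasonable G \<kappa>"
  obtains K where "0 \<le> K"
    "\<And>p. p \<in> beliefs \<Longrightarrow> - payoff_rate G \<kappa> p \<le> K * (expected_gain G p * expected_loss G p)"
proof -
  let ?A = "expected_gain G" and ?B = "expected_loss G"
  have \<kappa>: "continuous_on beliefs \<kappa>" "\<And>p. p \<in> beliefs \<Longrightarrow> 0 \<le> \<kappa> p \<and> \<kappa> p \<le> 1"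
    using r strategies_continuous by (auto simp: reasonable_def strategies_def)
  have cont: "continuous_on S ?A" "continuous_on S ?B" for S
    unfolding expected_gain_def expected_loss_def by (rule continuous_avg)+
  have nonneg: "0 \<le> ?A p" "0 \<le> ?B p" if "p \<in> beliefs" for p
    using that unfolding expected_gain_def expected_loss_def by (auto intro: avg_nonneg)
  define U where "U = top_of_set beliefs interior_of {p \<in> beliefs. \<kappa> p = 1}"
  define V where "V = top_of_set beliefs interior_of {p \<in> beliefs. \<kappa> p = 0}"
  have U: "openin (top_of_set beliefs) U" "beliefs_above G \<subseteq> U" "U \<subseteq> {p \<in> beliefs. \<kappa> p = 1}"
    and V: "openin (top_of_set beliefs) V" "beliefs_below G \<subseteq> V" "V \<subseteq> {p \<in> beliefs. \<kappa> p = 0}"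
    using r unfolding reasonable_def U_def V_def by (simp_all add: openin_interior_of interior_of_subset)
  have comp: "compact {p \<in> beliefs. \<kappa> p = c}" for c
    by (rule closedin_compact[OF compact_beliefs continuous_closedin_preimage_constant[OF \<kappa>(1)]])
  have "compact (beliefs - U - V)"
  proof -
    have "closedin (top_of_set beliefs) (beliefs - U - V)"
      by (intro closedin_diff U V) (rule closedin_subtopology_refl[THEN iffD2], simp)
    then show ?thesis by (rule closedin_compact[OF compact_beliefs])
  qed
  \<comment> \<open>Outside U and V the belief lies on neither face, so both factors are
    positive.\<close>
  moreover have "0 < ?A p * ?B p" if "p \<in> beliefs - U - V" for p
    using that U(2) V(2) nonneg[of p] by (auto simp: beliefs_above_iff beliefs_below_iff less_le)
  ultimately obtain c where c: "0 < c" "\<And>p. p \<in> beliefs - U - V \<Longrightarrow> c \<le> ?A p * ?B p"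
    using compact_positive_lower_bound[of "beliefs - U - V" "\<lambda>p. ?A p * ?B p"] continuous_on_mult[OF cont]
    by blast
  \<comment> \<open>The whole level set is used because it is compact, while U is only relatively
    open. It misses \<open>beliefs_below G\<close>, on which \<kappa> is 0.\<close>
  have "0 < ?A p" if "p \<in> {p \<in> beliefs. \<kappa> p = 1}" for p
  proof -
    have "p \<notin> beliefs_below G" using that V(2,3) by auto
    then show ?thesis using that nonneg[of p] by (auto simp: beliefs_below_iff less_le)
  qed
  then obtain c1 where c1: "0 < c1" "\<And>p. p \<in> {p \<in> beliefs. \<kappa> p = 1} \<Longrightarrow> c1 \<le> ?A p"
    using compact_positive_lower_bound[OF comp[of 1] cont(1)] by blast
  have "0 < ?B p" if "p \<in> {p \<in> beliefs. \<kappa> p = 0}" for p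
  proof -
    have "p \<notin> beliefs_above G" using that U(2,3) by auto
    then show ?thesis using that nonneg[of p] by (auto simp: beliefs_above_iff less_le)
  qed
  then obtain c0 where c0: "0 < c0" "\<And>p. p \<in> {p \<in> beliefs. \<kappa> p = 0} \<Longrightarrow> c0 \<le> ?B p"
    using compact_positive_lower_bound[OF comp[of 0] cont(2)] by blast
  have "bounded ((\<lambda>p. ?A p + ?B p) ` beliefs)"
    by (intro compact_imp_bounded compact_continuous_image compact_beliefs continuous_intros cont)
  then obtain D where D: "\<And>p. p \<in> beliefs \<Longrightarrow> \<bar>?A p + ?B p\<bar> \<le> D"
    unfolding bounded_iff by auto
  have D0: "0 \<le> max 0 D" by simp
  \<comment> \<open>One summand for each of three cases; the other two are nonnegative and only
    enlarge the bound.\<close>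
  have "- payoff_rate G \<kappa> p \<le> (max 0 D / c + 1 / c1 + 1 / c0) * (?A p * ?B p)" if p: "p \<in> beliefs" for p
  proof -
    have AB: "0 \<le> ?A p * ?B p" using nonneg[OF p] by simp
    consider "\<kappa> p = 1" | "\<kappa> p = 0" | "p \<in> beliefs - U - V" using p U(3) V(3) by blast
    then have "- payoff_rate G \<kappa> p \<le> max 0 D / c * (?A p * ?B p) \<or>
        - payoff_rate G \<kappa> p \<le> 1 / c1 * (?A p * ?B p) \<or> - payoff_rate G \<kappa> p \<le> 1 / c0 * (?A p * ?B p)"
    proof cases
      case 1
      then show ?thesis
        using c1(1) mult_right_mono[OF c1(2), of p "?B p"] nonneg[OF p] p by (simp add: payoff_rate_eq field_simps)
    next
      case 2
      then show ?thesis
        using c0(1) mult_left_mono[OF c0(2), of p "?A p"] nonneg[OF p] p by (simp add: payoff_rate_eq field_simps)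
    next
      case 3
      have "(1 - \<kappa> p) * ?A p + \<kappa> p * ?B p \<le> 1 * ?A p + 1 * ?B p"
        using \<kappa>(2)[OF p] nonneg[OF p] by (intro add_mono mult_right_mono) auto
      also have "\<dots> \<le> max 0 D" using D[OF p] by auto
      also have "max 0 D * 1 \<le> max 0 D * ((?A p * ?B p) / c)"
        using c(1) c(2)[OF 3] by (intro mult_left_mono) auto
      finally show ?thesis by (simp add: payoff_rate_eq)
    qed
    moreover have "0 \<le> max 0 D / c * (?A p * ?B p)" "0 \<le> 1 / c1 * (?A p * ?B p)" "0 \<le> 1 / c0 * (?A p * ?B p)"
      using AB D0 c(1) c1(1) c0(1) by (auto intro!: mult_nonneg_nonneg divide_nonneg_nonneg simp del: times_divide_eq_left)
    ultimately show ?thesis unfolding distrib_right by linarith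
  qed
  moreover have "0 \<le> max 0 D / c + 1 / c1 + 1 / c0" using c(1) c1(1) c0(1) by simp
  ultimately show ?thesis using that by blast
qed

section \<open>Expected accumulated variance\<close>

text \<open>The path is the pointwise limit of step functions sampling it at grid points to the
  right of t, by right-continuity. Clamping at 0 avoids negative times, where \<open>cadlag\<close>
  is silent.\<close>

lemma cadlag_borel_measurable:
  fixes f :: "real \<Rightarrow> 'a::metric_space"
  assumes "cadlag f"
  shows "(\<lambda>t. f (max 0 t)) \<in> borel_measurable borel"
proof (rule borel_measurable_LIMSEQ_metric)
  \<comment> \<open>Adding 1 puts the grid point strictly to the right of t, as convergence in
    \<open>at_right t\<close> requires.\<close>
  define s where "s = (\<lambda>(n::nat) (k::int). (of_int k + 1) / (real n + 1))"
  define r where "r = (\<lambda>n t. s n \<lfloor>(real n + 1) * t\<rfloor>)"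
  show "(\<lambda>t. f (max 0 (r n t))) \<in> borel_measurable borel" for n
  proof -
    have "(\<lambda>t::real. \<lfloor>(real n + 1) * t\<rfloor>) \<in> measurable borel (count_space UNIV)" by measurable
    then show ?thesis unfolding r_def by (rule measurable_compose) simp
  qed
  fix t :: real
  have r_gt: "t < r n t" for n
  proof -
    have "t = ((real n + 1) * t) / (real n + 1)" by simp
    also have "\<dots> < r n t"
      unfolding r_def s_def by (rule divide_strict_right_mono) auto
    finally show ?thesis .
  qed
  have r_le: "r n t \<le> t + inverse (real (Suc n))" for n
  proof -
    have "r n t \<le> ((real n + 1) * t + 1) / (real n + 1)"
      unfolding r_def s_def by (rule divide_right_mono) auto
    also have "\<dots> = t + inverse (real (Suc n))" by (simp add: add_divide_distrib inverse_eq_divide add.commute)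
    finally show ?thesis .
  qed
  have "(\<lambda>n. t + inverse (real (Suc n))) \<longlonglongrightarrow> t + 0"
    by (rule tendsto_add[OF tendsto_const LIMSEQ_inverse_real_of_nat])
  then have r_lim: "(\<lambda>n. r n t) \<longlonglongrightarrow> t"
    using r_gt r_le by (intro tendsto_sandwich[of "\<lambda>_. t" "\<lambda>n. r n t" sequentially "\<lambda>n. t + inverse (real (Suc n))"])
      (simp_all add: less_imp_le)
  show "(\<lambda>n. f (max 0 (r n t))) \<longlonglongrightarrow> f (max 0 t)"
  proof (cases "0 \<le> t")
    case True
    have "filterlim (\<lambda>n. r n t) (at_right t) sequentially"
      unfolding filterlim_at using r_lim r_gt by (simp add: less_imp_neq[symmetric])
    moreover have "(f \<longlongrightarrow> f t) (at_right t)" using assms True by (simp add: cadlag_def)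
    ultimately have "(\<lambda>n. f (r n t)) \<longlonglongrightarrow> f t" by (rule filterlim_compose[rotated])
    moreover have "max 0 (r n t) = r n t" for n using r_gt[of n] True by simp
    ultimately show ?thesis using True by simp
  next
    case False
    then have "\<forall>\<^sub>F n in sequentially. r n t < 0"
      using order_tendstoD(2)[OF r_lim, of 0] by simp
    then have "\<forall>\<^sub>F n in sequentially. f (max 0 (r n t)) = f (max 0 t)"
      by eventually_elim (use False in simp)
    then show ?thesis by (rule tendsto_eventually)
  qed
qed

lemma smooth_variance_nonneg: "p \<in> beliefs \<Longrightarrow> 0 \<le> e \<Longrightarrow> 0 \<le> smooth_variance G e p"
  unfolding smooth_variance_def
  by (intro sum_nonneg mult_nonneg_nonneg divide_nonneg_nonneg add_nonneg_nonneg state_prob_nonneg) auto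

lemma smooth_variance_tendsto:
  assumes "p \<in> beliefs"
  shows "(\<lambda>n. smooth_variance G (inverse (real (Suc n))) p) \<longlonglongrightarrow> payoff_variance G p"
proof -
  have "(\<lambda>n. (state_prob p l)\<^sup>2 / (state_prob p l + inverse (real (Suc n)))) \<longlonglongrightarrow> state_prob p l" for l
  proof (cases "state_prob p l = 0")
    case False
    have "(\<lambda>n. (state_prob p l)\<^sup>2 / (state_prob p l + inverse (real (Suc n)))) \<longlonglongrightarrow>
        (state_prob p l)\<^sup>2 / (state_prob p l + 0)"
      using False by (intro tendsto_divide tendsto_add tendsto_const LIMSEQ_inverse_real_of_nat) simp
    then show ?thesis using False by (simp add: power2_eq_square)
  qed simp
  then show ?thesis
    unfolding smooth_variance_def payoff_variance_def
    by (intro tendsto_sum tendsto_mult tendsto_const)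
qed

lemma measurable_smooth_variance [measurable]:
  "smooth_variance G e \<in> borel_measurable borel"
  unfolding smooth_variance_def[abs_def] exp_payoff_def avg_def by measurable

section \<open>Expectations from the martingale problem\<close>

lemma C2_const: "C2 (\<lambda>_ :: real ^ 'l::finite. 1)"
proof -
  have "C2 (\<lambda>p :: real ^ 'l. \<Sum>l\<in>UNIV. 1 * state_prob p l)"
    by (rule C2_state_prob_sum[where \<psi>' = "\<lambda>_. 1" and \<psi>'' = "\<lambda>_. 0"]) (auto intro!: derivative_eq_intros)
  then show ?thesis by (simp add: sum_state_prob)
qed

lemma generator_const: "generator G (\<lambda>_. c) p = 0" for G :: "'l::finite game"
proof -
  have "partial_deriv l (\<lambda>_. c) = (\<lambda>_. 0)" for l :: 'l and c :: real
    by (rule ext) (simp add: partial_deriv_def)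
  then show ?thesis by (simp add: generator_def)
qed

text \<open>Outside its intended domain \<open>real_cond_exp\<close> is 0.  The martingale property for the constant test
  function 1 therefore forces the observation fields to consist of measurable sets.\<close>
lemma play_of_subalgebra:
  assumes play: "play_of G \<kappa> p E" and t: "0 \<le> t"
  shows "subalgebra (sample E) (information G \<kappa> E t)"
proof (rule ccontr)
  assume *: "\<not> subalgebra (sample E) (information G \<kappa> E t)"
  interpret prob_space "sample E" using play by (simp add: play_of_def state_and_noise_def)
  have "martingale (sample E) (information G \<kappa> E)
      (\<lambda>t w. 1 - set_lebesgue_integral lborel {0..t} (\<lambda>r. profile_generator G \<kappa> (\<lambda>_. 1) (belief E r w)))"
    using play C2_const unfolding play_of_def by blast
  then have "martingale (sample E) (information G \<kappa> E) (\<lambda>t w. 1)"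
    by (simp add: profile_generator_def generator_const set_lebesgue_integral_def)
  then have "AE w in sample E. real_cond_exp (sample E) (information G \<kappa> E t) (\<lambda>w. 1) w = 1"
    using t unfolding martingale_def by blast
  then have "AE w in sample E. False"
    using * by (simp add: real_cond_exp_def nn_cond_exp_def)
  then show False by simp
qed

text \<open>Dynkin's formula: the accumulated drift has mean E[u(\<pi>_T)] - u(p), and both terms
  are at most C in absolute value. The bound is therefore independent of the horizon.\<close>

lemma play_of_expectation:
  assumes play: "play_of G \<kappa> p E" and T: "0 \<le> T"
    and u: "C2 u" "continuous_on UNIV u" "\<And>q. q \<in> beliefs \<Longrightarrow> \<bar>u q\<bar> \<le> C"
  defines "S \<equiv> \<lambda>w. set_lebesgue_integral lborel {0..T} (\<lambda>r. profile_generator G \<kappa> u (belief E r w))"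
  shows "integrable (sample E) S" and "(\<integral>w. S w \<partial>sample E) \<le> 2 * C"
proof -
  interpret prob_space "sample E" using play by (simp add: play_of_def state_and_noise_def)
  define V where "V = (\<lambda>t w. u (belief E t w) -
      set_lebesgue_integral lborel {0..t} (\<lambda>r. profile_generator G \<kappa> u (belief E r w)))"
  have b: "belief E 0 w = p" "0 \<le> t \<Longrightarrow> belief E t w \<in> beliefs" if "w \<in> space (sample E)" for t w
    using play that by (auto simp: play_of_def)
  have p: "p \<in> beliefs"
    using b not_empty by (metis all_not_in_conv order_refl)
  interpret F: finite_measure_subalgebra "sample E" "information G \<kappa> E 0"
    by unfold_locales (rule play_of_subalgebra[OF play order_refl])
  have "martingale (sample E) (information G \<kappa> E) V"
    using play u(1) unfolding play_of_def V_def by blast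
  then have VT: "integrable (sample E) (V T)" and V0: "integrable (sample E) (V 0)"
    and AE: "AE w in sample E. real_cond_exp (sample E) (information G \<kappa> E 0) (V T) w = V 0 w"
    using T unfolding martingale_def by auto
  have "belief E T \<in> borel_measurable (information G \<kappa> E T)"
    using play T by (auto simp: play_of_def markov_process_def)
  then have bT: "belief E T \<in> borel_measurable (sample E)"
    by (rule measurable_from_subalg[OF play_of_subalgebra[OF play T]])
  have "u \<in> borel_measurable borel" by (rule borel_measurable_continuous_onI[OF u(2)])
  then have ub_meas: "(\<lambda>w. u (belief E T w)) \<in> borel_measurable (sample E)"
    by (rule measurable_compose[OF bT])
  have ub: "integrable (sample E) (\<lambda>w. u (belief E T w))"
    by (rule integrable_const_bound[where B = C, OF AE_I2 ub_meas]) (use u(3) b(2) T in auto)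
  \<comment> \<open>Writing S through the martingale gives its integrability over the sample space
    without joint measurability in time and outcome.\<close>
  have S: "S = (\<lambda>w. u (belief E T w) - V T w)" by (simp add: S_def V_def)
  show "integrable (sample E) S" unfolding S by (rule Bochner_Integration.integrable_diff[OF ub VT])
  have "(\<integral>w. V T w \<partial>sample E) = (\<integral>w. real_cond_exp (sample E) (information G \<kappa> E 0) (V T) w \<partial>sample E)"
    by (rule F.real_cond_exp_int(2)[OF VT, symmetric])
  also have "\<dots> = (\<integral>w. V 0 w \<partial>sample E)"
    using V0 AE by (intro integral_cong_AE) auto
  also have "\<dots> = (\<integral>w. u p \<partial>sample E)"
  proof (rule Bochner_Integration.integral_cong[OF refl])
    fix w assume "w \<in> space (sample E)"
    moreover have "set_lebesgue_integral lborel {0..0} (\<lambda>r. profile_generator G \<kappa> u (belief E r w)) = 0"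
      unfolding set_lebesgue_integral_def
    proof (rule integral_eq_zero_AE)
      show "AE r in lborel. indicator {0..0::real} r *\<^sub>R profile_generator G \<kappa> u (belief E r w) = 0"
        using AE_lborel_singleton[of "0::real"] by eventually_elim simp
    qed
    ultimately show "V 0 w = u p" by (simp add: V_def b(1))
  qed
  finally have "(\<integral>w. V T w \<partial>sample E) = u p" by (simp add: prob_space)
  moreover have "(\<integral>w. u (belief E T w) \<partial>sample E) \<le> (\<integral>w. C \<partial>sample E)"
    using u(3)[OF b(2)[OF _ T]] by (intro integral_mono ub) (auto simp: abs_le_iff)
  ultimately show "(\<integral>w. S w \<partial>sample E) \<le> 2 * C"
    using u(3)[OF p] unfolding S by (simp add: Bochner_Integration.integral_diff[OF ub VT] prob_space)
qed

section \<open>Accumulated drift along the belief paths\<close>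

lemma strategies_measurable:
  "\<kappa> \<in> strategies \<Longrightarrow> \<kappa> \<in> borel_measurable (restrict_space borel beliefs)"
  by (intro borel_measurable_continuous_on_restrict strategies_continuous)

lemma total_experimentation_bounds:
  assumes "\<forall>i\<in>{1..N}. \<kappa> i \<in> strategies" and p: "p \<in> beliefs"
  shows "0 \<le> (\<Sum>i=1..N. \<kappa> i p)" "(\<Sum>i=1..N. \<kappa> i p) \<le> real N"
proof -
  have *: "0 \<le> \<kappa> i p" "\<kappa> i p \<le> 1" if "i \<in> {1..N}" for i
    using assms(1)[rule_format, OF that] p by (auto simp: strategies_def image_subset_iff)
  show "0 \<le> (\<Sum>i=1..N. \<kappa> i p)" by (rule sum_nonneg) (rule *)
  have "(\<Sum>i=1..N. \<kappa> i p) \<le> (\<Sum>i=1..N. 1)" by (rule sum_mono) (rule *)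
  then show "(\<Sum>i=1..N. \<kappa> i p) \<le> real N" by simp
qed

text \<open>Experimentation by the players can only raise the speed above the rate of the background
  signal, and the entropy drift that it multiplies is nonnegative.\<close>

lemma profile_generator_entropy_test_lower:
  fixes G :: "'l::{finite,linorder} game"
  assumes G: "experimentation_game G" and e: "0 < e" "e \<le> 1"
    and \<kappa>: "\<forall>i\<in>{1..players G}. \<kappa> i \<in> strategies" and p: "p \<in> beliefs"
  shows "bgrate G * learning_rate G * smooth_variance G e p \<le> profile_generator G \<kappa> (entropy_test e) p"
proof -
  let ?g = "learning_rate G * smooth_variance G e p"
  have g: "0 \<le> ?g"
    using learning_rate_pos[OF G] smooth_variance_nonneg[OF p, of e] e by simp
  have "0 < bgrate G" using G by (simp add: experimentation_game_def)
  then have "bgrate G * ?g \<le> (bgrate G + (\<Sum>i=1..players G. \<kappa> i p)) * generator G (entropy_test e) p"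
    by (intro mult_mono) (use total_experimentation_bounds[OF \<kappa> p] g generator_entropy_test_lower[OF G p e] in auto)
  then show ?thesis by (simp add: profile_generator_def mult.assoc)
qed

lemma profile_generator_entropy_test_nonneg:
  fixes G :: "'l::{finite,linorder} game"
  assumes G: "experimentation_game G" and e: "0 < e" "e \<le> 1"
    and \<kappa>: "\<forall>i\<in>{1..players G}. \<kappa> i \<in> strategies" and p: "p \<in> beliefs"
  shows "0 \<le> profile_generator G \<kappa> (entropy_test e) p"
proof -
  have "0 \<le> bgrate G * learning_rate G * smooth_variance G e p"
    using G learning_rate_pos[OF G] smooth_variance_nonneg[OF p, of e] e
    by (intro mult_nonneg_nonneg) (auto simp: experimentation_game_def)
  then show ?thesis by (rule order_trans[OF _ profile_generator_entropy_test_lower[OF assms]])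
qed

text \<open>The right side is a Bochner integral, which is 0 by default for a nonintegrable
  integrand. Measurability of the path and boundedness of the generator rule this out.\<close>

lemma entropy_drift_bound:
  fixes G :: "'l::{finite,linorder} game"
  assumes G: "experimentation_game G" and e: "0 < e" "e \<le> 1"
    and \<kappa>: "\<forall>i\<in>{1..players G}. \<kappa> i \<in> strategies"
    and b: "\<And>t. 0 \<le> t \<Longrightarrow> b t \<in> beliefs" "cadlag b"
  shows "(\<integral>\<^sup>+t. ennreal (bgrate G * learning_rate G * smooth_variance G e (b (max 0 t))) * indicator {0..T} t \<partial>lborel)
    \<le> ennreal (set_lebesgue_integral lborel {0..T} (\<lambda>t. profile_generator G \<kappa> (entropy_test e) (b t)))"
proof -
  let ?PG = "profile_generator G \<kappa> (entropy_test e)"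
  have bg: "0 < bgrate G" using G by (simp add: experimentation_game_def)
  note total = total_experimentation_bounds[OF \<kappa>]
  have lower: "bgrate G * learning_rate G * smooth_variance G e q \<le> ?PG q" if "q \<in> beliefs" for q
    by (rule profile_generator_entropy_test_lower[OF G e \<kappa> that])
  obtain C where C: "\<And>q. q \<in> beliefs \<Longrightarrow> \<bar>generator G (entropy_test e) q\<bar> \<le> C"
    using generator_entropy_test_bounded[OF G e] by blast
  have bound: "\<bar>?PG q\<bar> \<le> (bgrate G + real (players G)) * C" if "q \<in> beliefs" for q
    unfolding profile_generator_def abs_mult
    by (rule mult_mono) (use total[OF that] bg C[OF that] in auto)
  have "?PG \<in> borel_measurable (restrict_space borel beliefs)"
    unfolding profile_generator_def
    by (intro borel_measurable_times borel_measurable_add borel_measurable_sum borel_measurable_const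
        measurable_generator_entropy_test[OF G e(1)] strategies_measurable) (use \<kappa> in auto)
  moreover have bm: "(\<lambda>t. b (max 0 t)) \<in> borel_measurable borel"
    by (rule cadlag_borel_measurable[OF b(2)])
  then have "(\<lambda>t. b (max 0 t)) \<in> measurable borel (restrict_space borel beliefs)"
    using b(1) by (intro measurable_restrict_space2) auto
  ultimately have PGm: "(\<lambda>t. ?PG (b (max 0 t))) \<in> borel_measurable borel"
    by (rule measurable_compose[rotated])
  have int: "integrable lborel (\<lambda>t. indicator {0..T} t *\<^sub>R ?PG (b (max 0 t)))"
  proof (rule integrableI_bounded_set_indicator[where B = "(bgrate G + real (players G)) * C"])
    show "(\<lambda>t. ?PG (b (max 0 t))) \<in> borel_measurable lborel" using PGm by simp
    show "emeasure lborel {0..T} < \<infinity>" by (cases "0 \<le> T") auto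
    show "AE t in lborel. t \<in> {0..T} \<longrightarrow> norm (?PG (b (max 0 t))) \<le> (bgrate G + real (players G)) * C"
      using bound b(1) by auto
  qed simp
  have nonneg: "0 \<le> ?PG (b (max 0 t))" for t
    by (rule profile_generator_entropy_test_nonneg[OF G e \<kappa>]) (simp add: b(1))
  have "(\<integral>\<^sup>+t. ennreal (bgrate G * learning_rate G * smooth_variance G e (b (max 0 t))) * indicator {0..T} t \<partial>lborel) \<le>
      (\<integral>\<^sup>+t. ennreal (indicator {0..T} t *\<^sub>R ?PG (b (max 0 t))) \<partial>lborel)"
    using lower[OF b(1)] by (intro nn_integral_mono) (auto simp: indicator_def intro!: ennreal_leI)
  also have "\<dots> = ennreal (\<integral>t. indicator {0..T} t *\<^sub>R ?PG (b (max 0 t)) \<partial>lborel)"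
    using nonneg by (intro nn_integral_eq_integral[OF int] AE_I2) auto
  also have "(\<integral>t. indicator {0..T} t *\<^sub>R ?PG (b (max 0 t)) \<partial>lborel) =
      set_lebesgue_integral lborel {0..T} (\<lambda>t. ?PG (b t))"
    unfolding set_lebesgue_integral_def
    by (rule Bochner_Integration.integral_cong) (auto simp: indicator_def)
  finally show ?thesis .
qed

text \<open>Z is a measurable majorant, so the inner time integral need not be shown measurable in
  the outcome. Fatou is used twice: in time along each path, then over the sample space.\<close>

lemma expected_total_variance_bound:
  fixes G :: "'l::{finite,linorder} game"
  assumes G: "experimentation_game G"
    and \<kappa>: "\<forall>i\<in>{1..players G}. \<kappa> i \<in> strategies"
    and play: "play_of G \<kappa> p E"
  obtains Z where "Z \<in> borel_measurable (sample E)"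
    "\<And>w. w \<in> space (sample E) \<Longrightarrow>
      (\<integral>\<^sup>+t\<in>{0..}. ennreal (bgrate G * learning_rate G * payoff_variance G (belief E t w)) \<partial>lborel) \<le> Z w"
    "(\<integral>\<^sup>+w. Z w \<partial>sample E) \<le> ennreal (8 * (1 + real CARD('l)))"
proof -
  \<comment> \<open>Horizon n and smoothing 1 / (n + 1) share an index, so a single limit handles
    both.\<close>
  define e where "e = (\<lambda>n. inverse (real (Suc n)))"
  have e: "0 < e n" "e n \<le> 1" for n by (auto simp: e_def field_simps)
  let ?c = "bgrate G * learning_rate G"
  define S where "S = (\<lambda>n w. set_lebesgue_integral lborel {0..real n}
      (\<lambda>t. profile_generator G \<kappa> (entropy_test (e n)) (belief E t w)))"
  have c: "0 \<le> ?c"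
    using G learning_rate_pos[OF G] by (simp add: experimentation_game_def)
  have b: "0 \<le> t \<Longrightarrow> belief E t w \<in> beliefs" "cadlag (\<lambda>t. belief E t w)"
    if "w \<in> space (sample E)" for t w
    using play that by (auto simp: play_of_def)
  have S: "integrable (sample E) (S n)" "(\<integral>w. S n w \<partial>sample E) \<le> 2 * (4 * (1 + real CARD('l)))" for n
    unfolding S_def
    by (rule play_of_expectation[OF play of_nat_0_le_iff C2_entropy_test[OF e(1)]
        continuous_entropy_test[OF e(1)] entropy_test_bound[OF e]]; assumption)+
  have path: "(\<integral>\<^sup>+t\<in>{0..}. ennreal (?c * payoff_variance G (belief E t w)) \<partial>lborel) \<le>
      liminf (\<lambda>n. ennreal (S n w))" if w: "w \<in> space (sample E)" for w
  proof -
    define f where "f = (\<lambda>n t. ennreal (?c * smooth_variance G (e n) (belief E (max 0 t) w)) * indicator {0..real n} t)"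
    have bm: "(\<lambda>t. belief E (max 0 t) w) \<in> borel_measurable borel"
      using cadlag_borel_measurable[OF b(2)[OF w]] .
    have fm: "f n \<in> borel_measurable lborel" for n
    proof -
      have "(\<lambda>t. smooth_variance G (e n) (belief E (max 0 t) w)) \<in> borel_measurable borel"
        by (rule measurable_compose[OF bm measurable_smooth_variance])
      then show ?thesis unfolding f_def by simp
    qed
    have "ennreal (?c * payoff_variance G (belief E t w)) * indicator {0..} t \<le> liminf (\<lambda>n. f n t)" for t
    proof (cases "0 \<le> t")
      case True
      have "(\<lambda>n. ennreal (?c * smooth_variance G (e n) (belief E t w))) \<longlonglongrightarrow>
          ennreal (?c * payoff_variance G (belief E t w))"
        unfolding e_def
        by (intro tendsto_ennrealI tendsto_mult tendsto_const smooth_variance_tendsto b(1)[OF w True])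
      moreover have "\<forall>\<^sub>F n in sequentially. ennreal (?c * smooth_variance G (e n) (belief E t w)) = f n t"
        using eventually_ge_at_top[of "nat \<lceil>t\<rceil>"]
      proof eventually_elim
        case (elim n)
        then have "t \<le> real n" by linarith
        then show ?case using True by (simp add: f_def)
      qed
      ultimately have "(\<lambda>n. f n t) \<longlonglongrightarrow> ennreal (?c * payoff_variance G (belief E t w))"
        by (rule Lim_transform_eventually)
      then have "liminf (\<lambda>n. f n t) = ennreal (?c * payoff_variance G (belief E t w))"
        by (intro lim_imp_Liminf) auto
      then show ?thesis using True by simp
    qed simp
    then have "(\<integral>\<^sup>+t\<in>{0..}. ennreal (?c * payoff_variance G (belief E t w)) \<partial>lborel) \<le>
        (\<integral>\<^sup>+t. liminf (\<lambda>n. f n t) \<partial>lborel)"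
      by (rule nn_integral_mono)
    also have "\<dots> \<le> liminf (\<lambda>n. \<integral>\<^sup>+t. f n t \<partial>lborel)"
      by (rule nn_integral_liminf[OF fm])
    also have "\<dots> \<le> liminf (\<lambda>n. ennreal (S n w))"
      unfolding f_def S_def
      by (intro Liminf_mono always_eventually allI entropy_drift_bound[OF G e \<kappa> b[OF w]])
    finally show ?thesis .
  qed
  have "(\<integral>\<^sup>+w. ennreal (S n w) \<partial>sample E) \<le> ennreal (8 * (1 + real CARD('l)))" for n
  proof -
    have "0 \<le> S n w" if w: "w \<in> space (sample E)" for w
    proof -
      have "0 \<le> profile_generator G \<kappa> (entropy_test (e n)) (belief E t w)" if "0 \<le> t" for t
        by (rule profile_generator_entropy_test_nonneg[OF G e \<kappa> b(1)[OF w that]])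
      then show ?thesis unfolding S_def set_lebesgue_integral_def
        by (intro Bochner_Integration.integral_nonneg) (auto simp: indicator_def)
    qed
    then have "(\<integral>\<^sup>+w. ennreal (S n w) \<partial>sample E) = ennreal (\<integral>w. S n w \<partial>sample E)"
      by (intro nn_integral_eq_integral[OF S(1)] AE_I2)
    also have "\<dots> \<le> ennreal (8 * (1 + real CARD('l)))"
      using S(2)[of n] by (intro ennreal_leI) simp
    finally show ?thesis .
  qed
  then have *: "liminf (\<lambda>n. \<integral>\<^sup>+w. ennreal (S n w) \<partial>sample E) \<le> ennreal (8 * (1 + real CARD('l)))"
    by (intro order_trans[OF Liminf_le_Limsup Limsup_bounded] always_eventually) auto
  show ?thesis
  proof (rule that[of "\<lambda>w. liminf (\<lambda>n. ennreal (S n w))"])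
    show "(\<lambda>w. liminf (\<lambda>n. ennreal (S n w))) \<in> borel_measurable (sample E)"
      using S(1) by (intro borel_measurable_liminf) auto
    have "(\<integral>\<^sup>+w. liminf (\<lambda>n. ennreal (S n w)) \<partial>sample E) \<le> liminf (\<lambda>n. \<integral>\<^sup>+w. ennreal (S n w) \<partial>sample E)"
      using S(1) by (intro nn_integral_liminf) auto
    also note *
    finally show "(\<integral>\<^sup>+w. liminf (\<lambda>n. ennreal (S n w)) \<partial>sample E) \<le> ennreal (8 * (1 + real CARD('l)))" .
  qed (rule path)
qed

lemma payoff_lower_bound:
  fixes G :: "'l::{finite,linorder} game"
  assumes G: "experimentation_game G" and r: "reasonable G (\<kappa> n)"
    and \<kappa>: "\<forall>i\<in>{1..players G}. \<kappa> i \<in> strategies"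
  shows "\<exists>B\<ge>0. \<forall>p (E :: ('w, 'l) play). play_of G \<kappa> p E \<longrightarrow> - ereal B \<le> payoff G \<kappa> E n"
proof -
  obtain K where K: "0 \<le> K"
    "\<And>p. p \<in> beliefs \<Longrightarrow> - payoff_rate G (\<kappa> n) p \<le> K * (expected_gain G p * expected_loss G p)"
    using reasonable_shortfall_bound[OF r] by blast
  let ?c = "bgrate G * learning_rate G"
  \<comment> \<open>Shortfall per unit of variance, divided by the rate of information, times 2 * 4
    for each state from Dynkin's formula. Neither prior nor play enters.\<close>
  define B where "B = K / ?c * (8 * (1 + real CARD('l)))"
  have c: "0 < ?c" using G learning_rate_pos[OF G] by (simp add: experimentation_game_def)
  have B: "0 \<le> B" using K(1) c by (simp add: B_def)
  have rate: "- payoff_rate G (\<kappa> n) p \<le> K / ?c * (?c * payoff_variance G p)" if p: "p \<in> beliefs" for p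
  proof -
    have "0 \<le> expected_gain G p * expected_loss G p"
      unfolding expected_gain_def expected_loss_def by (intro mult_nonneg_nonneg avg_nonneg p) auto
    then have "expected_gain G p * expected_loss G p \<le> payoff_variance G p"
      using gain_loss_le_variance[OF p, of G] by linarith
    then have "- payoff_rate G (\<kappa> n) p \<le> K * payoff_variance G p"
      by (rule order_trans[OF K(2)[OF p] mult_left_mono[OF _ K(1)]])
    also have "\<dots> = K / ?c * (?c * payoff_variance G p)"
    proof -
      have "x = K / a * (a * y)" if "0 < a" "x = K * y" for a x y :: real using that by simp
      from this[OF c refl] show ?thesis .
    qed
    finally show ?thesis .
  qed
  have "- ereal B \<le> payoff G \<kappa> E n" if play: "play_of G \<kappa> p E" for p and E :: "('w, 'l) play"
  proof -
    let ?V = "\<lambda>w. \<integral>\<^sup>+t\<in>{0..}. ennreal (?c * payoff_variance G (belief E t w)) \<partial>lborel"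
    have path: "(\<integral>\<^sup>+t\<in>{0..}. ennreal (- payoff_rate G (\<kappa> n) (belief E t w)) \<partial>lborel) \<le> ennreal (K / ?c) * ?V w"
      if w: "w \<in> space (sample E)" for w
    proof -
      have b: "belief E t w \<in> beliefs" if "0 \<le> t" for t
        using play w that by (auto simp: play_of_def)
      have cad: "cadlag (\<lambda>t. belief E t w)"
        using play w by (auto simp: play_of_def)
      have "(\<lambda>p. payoff_variance G p) \<in> borel_measurable borel"
        unfolding payoff_variance_def exp_payoff_def avg_def by measurable
      then have "(\<lambda>t. payoff_variance G (belief E (max 0 t) w)) \<in> borel_measurable borel"
        by (rule measurable_compose[OF cadlag_borel_measurable[OF cad]])
      then have m: "(\<lambda>t. ennreal (?c * payoff_variance G (belief E (max 0 t) w)) * indicator {0..} t) \<in> borel_measurable lborel"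
        by simp
      have "(\<integral>\<^sup>+t\<in>{0..}. ennreal (- payoff_rate G (\<kappa> n) (belief E t w)) \<partial>lborel) \<le>
          (\<integral>\<^sup>+t. ennreal (K / ?c) * (ennreal (?c * payoff_variance G (belief E (max 0 t) w)) * indicator {0..} t) \<partial>lborel)"
        using rate[OF b] K(1) c
        by (intro nn_integral_mono) (auto simp: indicator_def ennreal_mult'[symmetric] intro!: ennreal_leI)
      also have "\<dots> = ennreal (K / ?c) * (\<integral>\<^sup>+t. ennreal (?c * payoff_variance G (belief E (max 0 t) w)) * indicator {0..} t \<partial>lborel)"
        by (rule nn_integral_cmult[OF m])
      also have "(\<integral>\<^sup>+t. ennreal (?c * payoff_variance G (belief E (max 0 t) w)) * indicator {0..} t \<partial>lborel) = ?V w"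
        by (rule nn_integral_cong) (simp add: indicator_def)
      finally show ?thesis .
    qed
    obtain Z where Z: "Z \<in> borel_measurable (sample E)" "\<And>w. w \<in> space (sample E) \<Longrightarrow> ?V w \<le> Z w"
      "(\<integral>\<^sup>+w. Z w \<partial>sample E) \<le> ennreal (8 * (1 + real CARD('l)))"
      using expected_total_variance_bound[OF G \<kappa> play] by blast
    have "(\<integral>\<^sup>+w. (\<integral>\<^sup>+t\<in>{0..}. ennreal (- payoff_rate G (\<kappa> n) (belief E t w)) \<partial>lborel) \<partial>sample E) \<le>
        (\<integral>\<^sup>+w. ennreal (K / ?c) * Z w \<partial>sample E)"
      \<comment> \<open>Monotonicity of the upper integral only compares the integrands pointwise,
        so passing to the measurable Z comes before any linearity is used.\<close>
      by (rule nn_integral_mono) (rule order_trans[OF path mult_left_mono[OF Z(2)]], auto)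
    also have "\<dots> = ennreal (K / ?c) * (\<integral>\<^sup>+w. Z w \<partial>sample E)"
      by (rule nn_integral_cmult[OF Z(1)])
    also have "\<dots> \<le> ennreal (K / ?c) * ennreal (8 * (1 + real CARD('l)))"
      by (rule mult_left_mono[OF Z(3)]) simp
    also have "\<dots> = ennreal B"
      unfolding B_def using K(1) c by (intro ennreal_mult[symmetric]) auto
    finally have "enn2ereal (\<integral>\<^sup>+w. (\<integral>\<^sup>+t\<in>{0..}. ennreal (- payoff_rate G (\<kappa> n) (belief E t w)) \<partial>lborel) \<partial>sample E) \<le>
        enn2ereal (ennreal B)"
      by (simp only: less_eq_ennreal.rep_eq)
    then show ?thesis
      unfolding payoff_def using B by (simp only: enn2ereal_ennreal ereal_minus_le_minus)
  qed
  with B show ?thesis by (intro exI[of _ B] conjI allI impI)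
qed

theorem mainTheorem2:
  fixes G :: "'l::{finite,linorder} game"
    and n :: nat
    and \<kappa>n :: "real ^ 'l::{finite,linorder} \<Rightarrow> real"
    and \<kappa>' :: "nat \<Rightarrow> real ^ 'l::{finite,linorder} \<Rightarrow> real"
    and E :: "real ^ 'l::{finite,linorder} \<Rightarrow> ('w, 'l::{finite,linorder}) play"
  assumes "experimentation_game G"
    and "n \<in> {1..players G}"
    and "\<kappa>n \<in> strategies"
    and "reasonable G \<kappa>n"
    and "\<forall>i\<in>{1..players G} - {n}. \<kappa>' i \<in> strategies"
    and "\<forall>p\<in>beliefs. play_of G (\<kappa>'(n := \<kappa>n)) p (E p)"
  shows "(\<forall>p\<in>beliefs. \<bar>payoff G (\<kappa>'(n := \<kappa>n)) (E p) n\<bar> \<noteq> \<infinity>) \<and>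
         bounded ((\<lambda>p. real_of_ereal (payoff G (\<kappa>'(n := \<kappa>n)) (E p) n)) ` beliefs)"
proof -
  let ?\<kappa> = "\<kappa>'(n := \<kappa>n)"
  have \<kappa>: "\<forall>i\<in>{1..players G}. ?\<kappa> i \<in> strategies"
  proof
    fix i assume "i \<in> {1..players G}"
    then show "?\<kappa> i \<in> strategies" using assms(3) bspec[OF assms(5), of i] by (cases "i = n") simp_all
  qed
  have r: "reasonable G (?\<kappa> n)" using assms(4) by simp
  \<comment> \<open>B is fixed ahead of prior and play, so one bound serves all \<open>E p\<close>,
    even though each may live on its own probability space.\<close>
  obtain B where B: "0 \<le> B"
    "\<forall>p (F :: ('w, 'l) play). play_of G ?\<kappa> p F \<longrightarrow> - ereal B \<le> payoff G ?\<kappa> F n"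
    using payoff_lower_bound[OF assms(1) r \<kappa>] by (elim exE conjE) (rule that)
  have *: "\<exists>r. payoff G ?\<kappa> (E p) n = ereal r \<and> \<bar>r\<bar> \<le> B" if p: "p \<in> beliefs" for p
  proof -
    have lo: "- ereal B \<le> payoff G ?\<kappa> (E p) n"
      by (rule B(2)[rule_format, OF assms(6)[rule_format, OF p]])
    have up: "payoff G ?\<kappa> (E p) n \<le> 0"
      unfolding payoff_def by (simp add: enn2ereal_nonneg)
    show ?thesis
    proof (cases "payoff G ?\<kappa> (E p) n")
      case (real r)
      then show ?thesis using lo up by (intro exI[of _ r]) simp
    qed (use lo up in simp_all)
  qed
  have "\<bar>payoff G ?\<kappa> (E p) n\<bar> \<noteq> \<infinity>" if "p \<in> beliefs" for p
    using *[OF that] by auto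
  moreover have "bounded ((\<lambda>p. real_of_ereal (payoff G ?\<kappa> (E p) n)) ` beliefs)"
  proof (rule boundedI[where B = B])
    fix y assume "y \<in> (\<lambda>p. real_of_ereal (payoff G ?\<kappa> (E p) n)) ` beliefs"
    then obtain p where "p \<in> beliefs" "y = real_of_ereal (payoff G ?\<kappa> (E p) n)" by blast
    with *[of p] show "norm y \<le> B" by auto
  qed
  ultimately show ?thesis by (intro conjI ballI)
qed

end
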